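(* Let $M$ be a smooth manifold of dimension $m$ and $\Sigma$ a smooth distribution on $M$ of rank $k$. Then $\Sigma$ is strong-bracket generating if and only if for every local frame $\{X_1,\dots,X_k,T_1,\dots,T_{m-k}\}$ of $TM$ such that $\{X_1,\dots,X_k\}$ is a basis of $\Gamma(\Sigma)$, the $k\times k$ matrix $[C_{ij}^\beta]_{i,j=1}^k$ is invertible for each $\beta=1,\dots,m-k$, where $C_{ij}^a$ and $C_{ij}^\beta$ are the coefficients determined by $$[X_i,X_j]=\sum_{a=1}^kC_{ij}^aX_a+\sum_{\beta=1}^{m-k}C_{ij}^\beta T_\beta .$$
   Context: Here $k<m$, a distribution is a smooth subbundle of $TM$, assumed not integrable, and $\Gamma(\Sigma)$ denotes the smooth vector fields tangent to $\Sigma$ (a basis of $\Gamma(\Sigma)$ being a local frame of $\Sigma$ on the domain considered). $\Sigma$ is strong-bracket generating if for each $p\in M$ and each nonzero $v\in\Sigma_p$ one has $\Sigma_p+[V,\Sigma]_p=T_pM$, where $V$ is any horizontal extension of $v$ (a local section of $\Sigma$ with $V(p)=v$) and $[V,\Sigma]_p=\{[V,W](p): W \text{ a local section of } \Sigma\}$. *)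

theory Defs
  imports
    "HOL-Analysis.Analysis"
    "HOL-Library.Function_Algebras"
    "HOL-Library.Set_Algebras"
begin

section \<open>Pointwise vector space structure on functions\<close>

instantiation "fun" :: (type, real_vector) real_vector
begin

definition scaleR_fun :: "real \<Rightarrow> ('a \<Rightarrow> 'b) \<Rightarrow> 'a \<Rightarrow> 'b"
  where "scaleR_fun r f = (\<lambda>x. r *\<^sub>R f x)"

instance
  by standard (auto simp: scaleR_fun_def fun_eq_iff scaleR_add_right scaleR_add_left)

end

section \<open>Smooth manifolds\<close>

text \<open>\<open>C_on n S f\<close> is meant for open \<open>S\<close>: all directional derivatives of \<open>f\<close> up to order \<open>n\<close>
  exist (as Frechet derivatives) and are continuous on \<open>S\<close>.\<close>

primrec C_on ::
  "nat \<Rightarrow> 'b::real_normed_vector set \<Rightarrow> ('b \<Rightarrow> 'c::real_normed_vector) \<Rightarrow> bool"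
  where
    "C_on 0 S f \<longleftrightarrow> continuous_on S f"
  | "C_on (Suc n) S f \<longleftrightarrow>
       (\<forall>x\<in>S. f differentiable (at x)) \<and>
       (\<forall>v. C_on n S (\<lambda>x. frechet_derivative f (at x) v))"

definition smooth_on ::
  "'b::real_normed_vector set \<Rightarrow> ('b \<Rightarrow> 'c::real_normed_vector) \<Rightarrow> bool"
  where "smooth_on S f \<longleftrightarrow> (\<forall>n. C_on n S f)"

text \<open>A chart is a pair of its domain and a coordinate map; the values of the coordinate map
  outside the domain are irrelevant.\<close>

type_synonym ('a, 'b) chart = "'a set \<times> ('a \<Rightarrow> 'b)"

definition is_chart :: "'a topology \<Rightarrow> ('a, 'b::euclidean_space) chart \<Rightarrow> bool"
  where "is_chart X c \<longleftrightarrow>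
    openin X (fst c) \<and> open (snd c ` fst c) \<and>
    homeomorphic_map (subtopology X (fst c)) (top_of_set (snd c ` fst c)) (snd c)"

definition chart_inv :: "('a, 'b) chart \<Rightarrow> 'b \<Rightarrow> 'a"
  where "chart_inv c = inv_into (fst c) (snd c)"

definition transition :: "('a, 'b) chart \<Rightarrow> ('a, 'b) chart \<Rightarrow> 'b \<Rightarrow> 'b"
  where "transition c d = snd d \<circ> chart_inv c"

definition compatible ::
  "('a, 'b::euclidean_space) chart \<Rightarrow> ('a, 'b) chart \<Rightarrow> bool"
  where "compatible c d \<longleftrightarrow>
    smooth_on (snd c ` (fst c \<inter> fst d)) (transition c d) \<and>
    smooth_on (snd d ` (fst c \<inter> fst d)) (transition d c)"

text \<open>\<open>A\<close> is a maximal smooth atlas on the second countable Hausdorff space \<open>X\<close>.  The dimension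
  of the manifold is the dimension of the model space \<open>'b\<close>.\<close>

definition smooth_manifold :: "'a topology \<Rightarrow> ('a, 'b::euclidean_space) chart set \<Rightarrow> bool"
  where "smooth_manifold X A \<longleftrightarrow>
    Hausdorff_space X \<and> second_countable X \<and>
    (\<forall>c\<in>A. is_chart X c) \<and>
    (\<Union>c\<in>A. fst c) = topspace X \<and>
    (\<forall>c\<in>A. \<forall>d\<in>A. compatible c d) \<and>
    (\<forall>c. is_chart X c \<and> (\<forall>d\<in>A. compatible c d) \<longrightarrow> c \<in> A)"

section \<open>Tangent vectors, vector fields and the Lie bracket\<close>

text \<open>A tangent vector at \<open>p\<close> is the family of its coordinate vectors in all charts around \<open>p\<close>;
  these are related by the derivatives of the transition maps.  The family is set to zero at all
  other arguments, so that equality and linear combinations of tangent vectors are those of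
  functions.\<close>

type_synonym ('a, 'b) tvec = "('a, 'b) chart \<Rightarrow> 'b"

definition tangent_space ::
  "('a, 'b::euclidean_space) chart set \<Rightarrow> 'a \<Rightarrow> ('a, 'b) tvec set"
  where "tangent_space A p = {v.
    (\<forall>c. \<not> (c \<in> A \<and> p \<in> fst c) \<longrightarrow> v c = 0) \<and>
    (\<forall>c\<in>A. \<forall>d\<in>A. p \<in> fst c \<and> p \<in> fst d \<longrightarrow>
       v d = frechet_derivative (transition c d) (at (snd c p)) (v c))}"

type_synonym ('a, 'b) vfield = "'a \<Rightarrow> ('a, 'b) tvec"

definition coord_rep :: "('a, 'b) chart \<Rightarrow> ('a, 'b) vfield \<Rightarrow> 'b \<Rightarrow> 'b"
  where "coord_rep c V = (\<lambda>x. V (chart_inv c x) c)"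

definition smooth_vfield ::
  "'a topology \<Rightarrow> ('a, 'b::euclidean_space) chart set \<Rightarrow> 'a set \<Rightarrow> ('a, 'b) vfield \<Rightarrow> bool"
  where "smooth_vfield X A U V \<longleftrightarrow>
    openin X U \<and> (\<forall>p\<in>U. V p \<in> tangent_space A p) \<and>
    (\<forall>c\<in>A. smooth_on (snd c ` (U \<inter> fst c)) (coord_rep c V))"

text \<open>In every chart, \<open>[V, W] = \<Sum>\<^sub>i\<^sub>j (V\<^sup>j \<partial>\<^sub>j W\<^sup>i - W\<^sup>j \<partial>\<^sub>j V\<^sup>i) \<partial>\<^sub>i\<close>.\<close>

definition lie_bracket ::
  "('a, 'b::euclidean_space) chart set \<Rightarrow> ('a, 'b) vfield \<Rightarrow> ('a, 'b) vfield \<Rightarrow> ('a, 'b) vfield"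
  where "lie_bracket A V W p = (\<lambda>c.
    if c \<in> A \<and> p \<in> fst c
    then frechet_derivative (coord_rep c W) (at (snd c p)) (V p c)
       - frechet_derivative (coord_rep c V) (at (snd c p)) (W p c)
    else 0)"

section \<open>Distributions\<close>

text \<open>The smooth fields \<open>Y i\<close>, \<open>i \<in> I\<close>, on \<open>U\<close> form a basis of \<open>S q\<close> at every \<open>q \<in> U\<close>.\<close>

definition local_frame ::
  "'a topology \<Rightarrow> ('a, 'b::euclidean_space) chart set \<Rightarrow> ('a \<Rightarrow> ('a, 'b) tvec set) \<Rightarrow>
   'a set \<Rightarrow> 'i set \<Rightarrow> ('i \<Rightarrow> ('a, 'b) vfield) \<Rightarrow> bool"
  where "local_frame X A S U I Y \<longleftrightarrow>
    openin X U \<and> (\<forall>i\<in>I. smooth_vfield X A U (Y i)) \<and>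
    (\<forall>q\<in>U. inj_on (\<lambda>i. Y i q) I \<and> independent ((\<lambda>i. Y i q) ` I) \<and>
            span ((\<lambda>i. Y i q) ` I) = S q)"

definition smooth_distribution ::
  "'a topology \<Rightarrow> ('a, 'b::euclidean_space) chart set \<Rightarrow> nat \<Rightarrow>
   ('a \<Rightarrow> ('a, 'b) tvec set) \<Rightarrow> bool"
  where "smooth_distribution X A k D \<longleftrightarrow>
    (\<forall>p\<in>topspace X. subspace (D p) \<and> D p \<subseteq> tangent_space A p \<and>
       (\<exists>U (Y :: nat \<Rightarrow> ('a, 'b) vfield). p \<in> U \<and> local_frame X A D U {..<k} Y))"

text \<open>\<open>N\<close> is an embedded submanifold with tangent spaces \<open>D q\<close>: around each of its points there
  is a slice chart in which \<open>N\<close> is an affine slice parallel to a linear subspace \<open>L\<close>, and the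
  tangent space of \<open>N\<close> consists of the vectors with coordinates in \<open>L\<close>.\<close>

definition integral_manifold ::
  "'a topology \<Rightarrow> ('a, 'b::euclidean_space) chart set \<Rightarrow> ('a \<Rightarrow> ('a, 'b) tvec set) \<Rightarrow>
   'a set \<Rightarrow> bool"
  where "integral_manifold X A D N \<longleftrightarrow>
    N \<subseteq> topspace X \<and>
    (\<forall>q\<in>N. \<exists>c\<in>A. \<exists>L. q \<in> fst c \<and> subspace L \<and>
       snd c ` (N \<inter> fst c) = snd c ` fst c \<inter> (\<lambda>u. snd c q + u) ` L \<and>
       D q = {v \<in> tangent_space A q. v c \<in> L})"

text \<open>Integral manifolds are only required locally, so embedded and immersed ones give the same
  notion.\<close>

definition integrable_distribution ::
  "'a topology \<Rightarrow> ('a, 'b::euclidean_space) chart set \<Rightarrow> ('a \<Rightarrow> ('a, 'b) tvec set) \<Rightarrow> bool"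
  where "integrable_distribution X A D \<longleftrightarrow>
    (\<forall>p\<in>topspace X. \<exists>N. p \<in> N \<and> integral_manifold X A D N)"

definition sections ::
  "'a topology \<Rightarrow> ('a, 'b::euclidean_space) chart set \<Rightarrow> ('a \<Rightarrow> ('a, 'b) tvec set) \<Rightarrow>
   'a set \<Rightarrow> ('a, 'b) vfield set"
  where "sections X A D U = {V. smooth_vfield X A U V \<and> (\<forall>q\<in>U. V q \<in> D q)}"

definition bracket_set ::
  "'a topology \<Rightarrow> ('a, 'b::euclidean_space) chart set \<Rightarrow> ('a \<Rightarrow> ('a, 'b) tvec set) \<Rightarrow>
   ('a, 'b) vfield \<Rightarrow> 'a \<Rightarrow> ('a, 'b) tvec set"
  where "bracket_set X A D V p = {lie_bracket A V W p | W U. p \<in> U \<and> W \<in> sections X A D U}"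

definition strong_bracket_generating ::
  "'a topology \<Rightarrow> ('a, 'b::euclidean_space) chart set \<Rightarrow> ('a \<Rightarrow> ('a, 'b) tvec set) \<Rightarrow> bool"
  where "strong_bracket_generating X A D \<longleftrightarrow>
    (\<forall>p\<in>topspace X. \<forall>v\<in>D p. v \<noteq> 0 \<longrightarrow>
       (\<forall>U V. p \<in> U \<and> V \<in> sections X A D U \<and> V p = v \<longrightarrow>
          D p + bracket_set X A D V p = tangent_space A p))"

end

theory Submission
  imports Defs
begin

text \<open>Write \<open>D\<close> for the distribution and \<open>Q = T\<^sub>pM / D\<^sub>p\<close>. The reason for the equivalence is that the
  bracket of two sections of \<open>D\<close>, taken modulo \<open>D\<close>, depends only on their values at \<open>p\<close>; it is an
  alternating bilinear map \<open>B\<close> from \<open>D\<^sub>p \<times> D\<^sub>p\<close> to \<open>Q\<close>. Strong bracket generation says that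
  \<open>B(v, -)\<close> is onto \<open>Q\<close> for every nonzero \<open>v\<close>. A linear map into \<open>Q\<close> fails to be onto exactly if
  some nonzero functional \<open>\<lambda>\<close> on \<open>Q\<close> vanishes on its image, so strong bracket generation says that the
  bilinear form \<open>\<lambda> \<circ> B\<close> is nondegenerate for every nonzero \<open>\<lambda>\<close>. The matrix of the coefficients
  \<open>C\<^sub>i\<^sub>j\<^sup>\<beta>\<close> is the matrix of \<open>\<lambda> \<circ> B\<close> for the member \<open>\<lambda>\<close> of the dual frame that belongs to \<open>T\<^sub>\<beta>\<close>.
  Frames being arbitrary, every nonzero \<open>\<lambda>\<close> arises in this way.

  That \<open>B\<close> is well defined (\<open>lie_bracket_mod_frame\<close>) is proved without differentiating the
  coefficients of a section with respect to a frame: a section that vanishes at \<open>p\<close> has its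
  derivative at \<open>p\<close> in \<open>D\<^sub>p\<close>, because the difference quotients are multiples of its values at points that
  tend to \<open>p\<close>, and a frame stays uniformly independent near \<open>p\<close> (\<open>derivative_in_span_at_zero\<close>).

  Three further facts connect this linear algebra with the manifold. The Lie bracket, given by a
  formula in each chart, is a tangent vector (\<open>lie_bracket_tangent\<close>); this rests on the symmetry of
  the second derivative of a transition map (\<open>mixed_derivatives_commute\<close>). A tangent vector is
  determined by its coordinates in one chart, and these are arbitrary. Finally, a frame with a
  prescribed functional \<open>\<lambda>\<close> at \<open>p\<close> is found by adding to a frame of \<open>D\<close> fields that are constant in
  one chart (\<open>frame_with_prescribed_conormal\<close>).\<close>

section \<open>Functions of class C^n\<close>

lemma frechet_derivative_eqI:
  "(f has_derivative f') (at x) \<Longrightarrow> frechet_derivative f (at x) = f'"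
  by (metis frechet_derivative_at)

lemma C_on_cong:
  assumes "open S" "\<And>x. x \<in> S \<Longrightarrow> f x = g x" "C_on n S f"
  shows "C_on n S g"
  using assms(2,3)
proof (induction n arbitrary: f g)
  case 0
  then show ?case by (simp cong: continuous_on_cong)
next
  case (Suc n)
  have d: "g differentiable (at x)" "frechet_derivative f (at x) = frechet_derivative g (at x)"
    if "x \<in> S" for x
  proof -
    have f: "f differentiable (at x)" using Suc that by simp
    then have "(f has_derivative frechet_derivative f (at x)) (at x)"
      by (simp add: frechet_derivative_works)
    then have "(g has_derivative frechet_derivative f (at x)) (at x)"
      using has_derivative_transform_within_open[OF _ assms(1) that] Suc(2) by blast
    then show "g differentiable (at x)" by (auto simp: differentiable_def)
    show "frechet_derivative f (at x) = frechet_derivative g (at x)"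
      using frechet_derivative_transform_within_open[OF f assms(1) that] Suc(2) by blast
  qed
  have "C_on n S (\<lambda>x. frechet_derivative g (at x) v)" for v
    by (rule Suc.IH[of "\<lambda>x. frechet_derivative f (at x) v"]) (use d Suc.prems in auto)
  then show ?case using d by simp
qed

lemma C_on_subset: "C_on n S f \<Longrightarrow> S' \<subseteq> S \<Longrightarrow> C_on n S' f"
  by (induction n arbitrary: f) (auto intro: continuous_on_subset)

lemma C_on_SucD: "C_on (Suc n) S f \<Longrightarrow> C_on n S f"
proof (induction n arbitrary: f)
  case 0
  then show ?case
    by (auto intro: differentiable_imp_continuous_within continuous_at_imp_continuous_on)
next
  case (Suc n)
  then show ?case by (metis C_on.simps(2))
qed

lemma C_on_const: "C_on n S (\<lambda>x. c)"
  by (induction n arbitrary: c) auto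

lemma C_on_add:
  assumes "open S" "C_on n S f" "C_on n S g"
  shows "C_on n S (\<lambda>x. f x + g x)"
  using assms(2,3)
proof (induction n arbitrary: f g)
  case 0
  then show ?case by (simp add: continuous_on_add)
next
  case (Suc n)
  have d: "((\<lambda>x. f x + g x) has_derivative
      (\<lambda>v. frechet_derivative f (at x) v + frechet_derivative g (at x) v)) (at x)"
    if "x \<in> S" for x
    using Suc.prems that by (intro has_derivative_add) (auto simp: frechet_derivative_works)
  have "C_on n S (\<lambda>x. frechet_derivative (\<lambda>x. f x + g x) (at x) v)" for v
    by (rule C_on_cong[OF assms(1) _ Suc.IH[of "\<lambda>x. frechet_derivative f (at x) v"
            "\<lambda>x. frechet_derivative g (at x) v"]])
      (use Suc.prems in \<open>auto simp: frechet_derivative_eqI[OF d]\<close>)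
  then show ?case using d by (auto simp: differentiable_def)
qed

lemma C_on_sum:
  assumes "open S" "\<And>i. i \<in> I \<Longrightarrow> C_on n S (f i)"
  shows "C_on n S (\<lambda>x. \<Sum>i\<in>I. f i x)"
  using assms(2)
  by (induction I rule: infinite_finite_induct) (auto intro: C_on_add assms(1) C_on_const)

text \<open>The product rule turns the derivative into a sum of two terms of the same kind, of one order
  less.\<close>
lemma C_on_bilinear:
  assumes "bounded_bilinear B" "open S" "C_on n S f" "C_on n S g"
  shows "C_on n S (\<lambda>x. B (f x) (g x))"
  using assms(3,4)
proof (induction n arbitrary: f g)
  case 0
  then show ?case using bounded_bilinear.continuous_on[OF assms(1)] by simp
next
  case (Suc n)
  have d: "((\<lambda>x. B (f x) (g x)) has_derivative
      (\<lambda>v. B (f x) (frechet_derivative g (at x) v) + B (frechet_derivative f (at x) v) (g x))) (at x)"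
    if "x \<in> S" for x
    using Suc.prems that
    by (intro bounded_bilinear.FDERIV[OF assms(1)]) (auto simp: frechet_derivative_works)
  have "C_on n S (\<lambda>x. frechet_derivative (\<lambda>x. B (f x) (g x)) (at x) v)" for v
  proof (rule C_on_cong[OF assms(2)])
    show "C_on n S (\<lambda>x. B (f x) (frechet_derivative g (at x) v) + B (frechet_derivative f (at x) v) (g x))"
      by (intro C_on_add assms(2) Suc.IH) (use Suc.prems C_on_SucD in \<open>auto\<close>)
  qed (simp add: frechet_derivative_eqI[OF d])
  then show ?case using d by (auto simp: differentiable_def)
qed

lemma linear_sum_Basis:
  assumes "linear (f :: 'b::euclidean_space \<Rightarrow> 'c::real_vector)"
  shows "f v = (\<Sum>b\<in>Basis. (v \<bullet> b) *\<^sub>R f b)"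
proof -
  have "f v = f (\<Sum>b\<in>Basis. (v \<bullet> b) *\<^sub>R b)" by (simp add: euclidean_representation)
  then show ?thesis by (simp add: linear_sum[OF assms] linear_scale[OF assms])
qed

text \<open>By the chain rule, the derivative of the composition in direction \<open>v\<close> is the derivative of \<open>f\<close>
  in a direction that varies with the point. Expanding this direction in a basis of the finite
  dimensional middle space leaves only derivatives of \<open>f\<close> in fixed directions, to which the induction
  hypothesis applies.\<close>
lemma C_on_compose:
  fixes f :: "'b::euclidean_space \<Rightarrow> 'c::real_normed_vector"
  assumes "open S" "C_on n S g" "C_on n T f" "g ` S \<subseteq> T"
  shows "C_on n S (\<lambda>x. f (g x))"
  using assms(2,3)
proof (induction n arbitrary: f)
  case 0
  then show ?case using continuous_on_compose2[OF _ _ assms(4)] by auto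
next
  case (Suc n)
  have d: "((\<lambda>x. f (g x)) has_derivative
      (\<lambda>v. frechet_derivative f (at (g x)) (frechet_derivative g (at x) v))) (at x)"
    if "x \<in> S" for x
    using Suc.prems that assms(4)
    by (intro has_derivative_compose[of g _ x UNIV f]) (auto simp: frechet_derivative_works)
  have "C_on n S (\<lambda>x. frechet_derivative (\<lambda>x. f (g x)) (at x) v)" for v
  proof (rule C_on_cong[OF assms(1)])
    show "C_on n S (\<lambda>x. \<Sum>b\<in>Basis. (frechet_derivative g (at x) v \<bullet> b) *\<^sub>R frechet_derivative f (at (g x)) b)"
      using Suc.prems C_on_SucD
      by (intro C_on_sum assms(1) C_on_bilinear[OF bounded_bilinear_scaleR]
            C_on_bilinear[OF bounded_bilinear_inner] Suc.IH C_on_const) auto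
    fix x assume x: "x \<in> S"
    have "linear (frechet_derivative f (at (g x)))"
      using Suc.prems(2) x assms(4) by (intro linear_frechet_derivative) auto
    then show "(\<Sum>b\<in>Basis. (frechet_derivative g (at x) v \<bullet> b) *\<^sub>R frechet_derivative f (at (g x)) b)
        = frechet_derivative (\<lambda>x. f (g x)) (at x) v"
      using frechet_derivative_eqI[OF d[OF x]] linear_sum_Basis by metis
  qed
  then show ?case using d by (auto simp: differentiable_def)
qed

section \<open>Symmetry of the second derivative\<close>

text \<open>The mean value theorem is applied twice, first along \<open>a\<close> and then along \<open>b\<close>. The left side of the
  equation is symmetric in \<open>a\<close> and \<open>b\<close>, and the right side is not; this gives the symmetry of the
  second derivative in the limit \<open>t \<rightarrow> 0\<close>.\<close>
lemma second_difference_eq_mixed_derivative: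
  fixes f :: "'b::real_normed_vector \<Rightarrow> real"
  assumes f: "C_on 2 (ball x r) f" and t: "0 < t" "t * (norm a + norm b) < r"
  shows "\<exists>y. norm (y - x) \<le> t * (norm a + norm b) \<and>
    f (x + t *\<^sub>R a + t *\<^sub>R b) - f (x + t *\<^sub>R a) - f (x + t *\<^sub>R b) + f x
      = t\<^sup>2 * frechet_derivative (\<lambda>z. frechet_derivative f (at z) a) (at y) b"
proof -
  have in_ball: "norm (s *\<^sub>R a + u *\<^sub>R b) \<le> t * (norm a + norm b)" "x + s *\<^sub>R a + u *\<^sub>R b \<in> ball x r"
    if "0 \<le> s" "s \<le> t" "0 \<le> u" "u \<le> t" for s u
  proof -
    have "norm (s *\<^sub>R a + u *\<^sub>R b) \<le> s * norm a + u * norm b"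
      using that norm_triangle_ineq[of "s *\<^sub>R a" "u *\<^sub>R b"] by simp
    also have "\<dots> \<le> t * (norm a + norm b)"
      using that by (simp add: distrib_left add_mono mult_right_mono)
    finally show *: "norm (s *\<^sub>R a + u *\<^sub>R b) \<le> t * (norm a + norm b)" .
    have "dist x (x + s *\<^sub>R a + u *\<^sub>R b) = norm (s *\<^sub>R a + u *\<^sub>R b)"
      by (metis add.assoc dist_add_cancel dist_0_norm add.right_neutral)
    then show "x + s *\<^sub>R a + u *\<^sub>R b \<in> ball x r"
      using * t by simp
  qed
  have diff: "(f has_derivative frechet_derivative f (at y)) (at y)"
     "((\<lambda>z. frechet_derivative f (at z) a) has_derivative
        frechet_derivative (\<lambda>z. frechet_derivative f (at z) a) (at y)) (at y)"
    if "y \<in> ball x r" for y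
    using f that by (auto simp: numeral_2_eq_2 frechet_derivative_works)
  have along_a: "((\<lambda>s. f (x + s *\<^sub>R a + u *\<^sub>R b)) has_real_derivative
     frechet_derivative f (at (x + s *\<^sub>R a + u *\<^sub>R b)) a) (at s)"
    if "0 \<le> s" "s \<le> t" "0 \<le> u" "u \<le> t" for s u
  proof -
    have lin: "linear (frechet_derivative f (at (x + s *\<^sub>R a + u *\<^sub>R b)))"
      by (rule has_derivative_linear[OF diff(1)[OF in_ball(2)[OF that]]])
    have "((\<lambda>s. f (x + s *\<^sub>R a + u *\<^sub>R b)) has_derivative
        (\<lambda>h. frechet_derivative f (at (x + s *\<^sub>R a + u *\<^sub>R b)) (h *\<^sub>R a))) (at s)"
      by (rule has_derivative_compose[of "\<lambda>s. x + s *\<^sub>R a + u *\<^sub>R b" _ s UNIV f, OF _ diff(1)[OF in_ball(2)[OF that]]])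
        (auto intro!: derivative_eq_intros)
    then show ?thesis
      by (simp add: has_field_derivative_def linear_scale[OF lin] mult_commute_abs)
  qed
  have along_b: "((\<lambda>u. frechet_derivative f (at (x + s *\<^sub>R a + u *\<^sub>R b)) a) has_real_derivative
     frechet_derivative (\<lambda>z. frechet_derivative f (at z) a) (at (x + s *\<^sub>R a + u *\<^sub>R b)) b) (at u)"
    if "0 \<le> s" "s \<le> t" "0 \<le> u" "u \<le> t" for s u
  proof -
    let ?G = "\<lambda>z. frechet_derivative f (at z) a"
    have lin: "linear (frechet_derivative ?G (at (x + s *\<^sub>R a + u *\<^sub>R b)))"
      by (rule has_derivative_linear[OF diff(2)[OF in_ball(2)[OF that]]])
    have "((\<lambda>u. ?G (x + s *\<^sub>R a + u *\<^sub>R b)) has_derivative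
        (\<lambda>h. frechet_derivative ?G (at (x + s *\<^sub>R a + u *\<^sub>R b)) (h *\<^sub>R b))) (at u)"
      by (rule has_derivative_compose[of "\<lambda>u. x + s *\<^sub>R a + u *\<^sub>R b" _ u UNIV ?G, OF _ diff(2)[OF in_ball(2)[OF that]]])
        (auto intro!: derivative_eq_intros)
    then show ?thesis
      by (simp add: has_field_derivative_def linear_scale[OF lin] mult_commute_abs)
  qed
  have "\<exists>s. 0 < s \<and> s < t \<and>
      (f (x + t *\<^sub>R a + t *\<^sub>R b) - f (x + t *\<^sub>R a + 0 *\<^sub>R b))
      - (f (x + 0 *\<^sub>R a + t *\<^sub>R b) - f (x + 0 *\<^sub>R a + 0 *\<^sub>R b))
      = (t - 0) * (frechet_derivative f (at (x + s *\<^sub>R a + t *\<^sub>R b)) a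
          - frechet_derivative f (at (x + s *\<^sub>R a + 0 *\<^sub>R b)) a)"
    by (rule MVT2[OF t(1)]) (rule DERIV_diff; rule along_a; use t in simp)
  then obtain s where s: "0 < s" "s < t"
      "f (x + t *\<^sub>R a + t *\<^sub>R b) - f (x + t *\<^sub>R a) - f (x + t *\<^sub>R b) + f x
      = t * (frechet_derivative f (at (x + s *\<^sub>R a + t *\<^sub>R b)) a
          - frechet_derivative f (at (x + s *\<^sub>R a + 0 *\<^sub>R b)) a)"
    by (auto simp: algebra_simps)
  have "\<exists>u. 0 < u \<and> u < t \<and> frechet_derivative f (at (x + s *\<^sub>R a + t *\<^sub>R b)) a
          - frechet_derivative f (at (x + s *\<^sub>R a + 0 *\<^sub>R b)) a
       = (t - 0) * frechet_derivative (\<lambda>z. frechet_derivative f (at z) a) (at (x + s *\<^sub>R a + u *\<^sub>R b)) b"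
    by (rule MVT2[OF t(1)]) (rule along_b; use s in simp)
  then obtain u where u: "0 < u" "u < t"
    "frechet_derivative f (at (x + s *\<^sub>R a + t *\<^sub>R b)) a
          - frechet_derivative f (at (x + s *\<^sub>R a + 0 *\<^sub>R b)) a
       = t * frechet_derivative (\<lambda>z. frechet_derivative f (at z) a) (at (x + s *\<^sub>R a + u *\<^sub>R b)) b"
    by auto
  show ?thesis
    using in_ball(1)[of s u] s u
    by (intro exI[of _ "x + s *\<^sub>R a + u *\<^sub>R b"]) (auto simp: power2_eq_square algebra_simps)
qed

lemma mixed_derivatives_commute_real:
  fixes f :: "'b::real_normed_vector \<Rightarrow> real"
  assumes "open S" "x \<in> S" "C_on 2 S f"
  shows "frechet_derivative (\<lambda>z. frechet_derivative f (at z) a) (at x) b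
       = frechet_derivative (\<lambda>z. frechet_derivative f (at z) b) (at x) a"
proof -
  let ?G = "\<lambda>a b y. frechet_derivative (\<lambda>z. frechet_derivative f (at z) a) (at y) b"
  obtain r where r: "r > 0" "ball x r \<subseteq> S" using assms by (meson openE)
  have f: "C_on 2 (ball x r) f" using assms(3) r(2) C_on_subset by blast
  have cont: "isCont (?G a b) x" for a b
    using assms by (auto simp: numeral_2_eq_2 continuous_on_eq_continuous_at)
  have close: "\<bar>?G a b x - ?G b a x\<bar> < 2 * e" if "e > 0" for e
  proof -
    obtain d1 where d1: "d1 > 0" "\<And>y. dist y x < d1 \<Longrightarrow> dist (?G a b y) (?G a b x) < e"
      using cont[of a b] \<open>e > 0\<close> unfolding continuous_at_eps_delta by metis
    obtain d2 where d2: "d2 > 0" "\<And>y. dist y x < d2 \<Longrightarrow> dist (?G b a y) (?G b a x) < e"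
      using cont[of b a] \<open>e > 0\<close> unfolding continuous_at_eps_delta by metis
    define R where "R = min r (min d1 d2)"
    have "R > 0" using r d1 d2 by (simp add: R_def)
    \<comment> \<open>Small enough that the intermediate points stay within \<open>R\<close> of \<open>x\<close>; the summand \<open>1\<close> covers
      \<open>a = b = 0\<close>.\<close>
    define t where "t = R / (norm a + norm b + 1)"
    have pos: "norm a + norm b + 1 > 0" by (simp add: add_nonneg_pos)
    then have t: "t > 0" using \<open>R > 0\<close> by (simp add: t_def)
    have "t * (norm a + norm b) < t * (norm a + norm b + 1)" using t by simp
    also have "\<dots> = R" using pos by (simp add: t_def)
    finally have tR: "t * (norm a + norm b) < R" .
    obtain y1 where y1: "norm (y1 - x) \<le> t * (norm a + norm b)"
      "f (x + t *\<^sub>R a + t *\<^sub>R b) - f (x + t *\<^sub>R a) - f (x + t *\<^sub>R b) + f x = t\<^sup>2 * ?G a b y1"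
      using second_difference_eq_mixed_derivative[OF f t, of a b] tR by (auto simp: R_def)
    obtain y2 where y2: "norm (y2 - x) \<le> t * (norm a + norm b)"
      "f (x + t *\<^sub>R b + t *\<^sub>R a) - f (x + t *\<^sub>R b) - f (x + t *\<^sub>R a) + f x = t\<^sup>2 * ?G b a y2"
      using second_difference_eq_mixed_derivative[OF f t, of b a] tR by (auto simp: R_def add.commute)
    have "t\<^sup>2 * ?G a b y1 = t\<^sup>2 * ?G b a y2"
      using y1(2) y2(2) by (simp add: algebra_simps)
    then have "?G a b y1 = ?G b a y2" using t by simp
    moreover have "dist (?G a b y1) (?G a b x) < e" "dist (?G b a y2) (?G b a x) < e"
      using d1(2)[of y1] d2(2)[of y2] y1(1) y2(1) tR by (auto simp: R_def dist_norm)
    ultimately show ?thesis by (simp add: dist_real_def)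
  qed
  show ?thesis
  proof (rule ccontr)
    assume "?G a b x \<noteq> ?G b a x"
    then show False using close[of "\<bar>?G a b x - ?G b a x\<bar> / 2"] by simp
  qed
qed

lemma mixed_derivatives_commute:
  fixes f :: "'b::real_normed_vector \<Rightarrow> 'c::euclidean_space"
  assumes "open S" "x \<in> S" "C_on 2 S f"
  shows "frechet_derivative (\<lambda>z. frechet_derivative f (at z) a) (at x) b
       = frechet_derivative (\<lambda>z. frechet_derivative f (at z) b) (at x) a"
proof (rule euclidean_eqI)
  fix e :: 'c assume "e \<in> Basis"
  have inner: "frechet_derivative (\<lambda>z. h z \<bullet> e) (at y) v = frechet_derivative h (at y) v \<bullet> e"
    if "h differentiable (at y)" for h :: "'b \<Rightarrow> 'c" and y v
  proof -
    have "((\<lambda>z. h z \<bullet> e) has_derivative (\<lambda>v. frechet_derivative h (at y) v \<bullet> e)) (at y)"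
      using that by (intro has_derivative_inner_left) (simp add: frechet_derivative_works)
    then show ?thesis by (simp add: frechet_derivative_eqI)
  qed
  let ?f = "\<lambda>z. f z \<bullet> e"
  have f: "f differentiable (at y)" "(\<lambda>z. frechet_derivative f (at z) a) differentiable (at y)"
    if "y \<in> S" for y a
    using that assms(3) by (auto simp: numeral_2_eq_2)
  have second: "frechet_derivative (\<lambda>z. frechet_derivative ?f (at z) a) (at x) b
     = frechet_derivative (\<lambda>z. frechet_derivative f (at z) a) (at x) b \<bullet> e" for a b
  proof -
    have "frechet_derivative (\<lambda>z. frechet_derivative f (at z) a \<bullet> e) (at x)
        = frechet_derivative (\<lambda>z. frechet_derivative ?f (at z) a) (at x)"
      using f assms(1,2) inner
      by (intro frechet_derivative_transform_within_open[of _ x S])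
        (auto intro!: differentiable_inner)
    then show ?thesis using inner f assms(2) by metis
  qed
  have "C_on 2 S ?f"
    by (intro C_on_bilinear[OF bounded_bilinear_inner] assms C_on_const)
  then show "frechet_derivative (\<lambda>z. frechet_derivative f (at z) a) (at x) b \<bullet> e
       = frechet_derivative (\<lambda>z. frechet_derivative f (at z) b) (at x) a \<bullet> e"
    using mixed_derivatives_commute_real[OF assms(1,2)] second by metis
qed

section \<open>Families of independent vectors that vary continuously\<close>

text \<open>An injective linear map from a finite dimensional space is bounded below, and a perturbation of
  norm less than half of the bound preserves this. Independence is therefore an open condition, with
  a uniform bound on coefficients near \<open>x0\<close>.\<close>
lemma eventually_combination_lower_bound:
  fixes F :: "'i::finite \<Rightarrow> 'b::t2_space \<Rightarrow> 'c::euclidean_space"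
  assumes cont: "\<And>i. isCont (F i) x0"
    and inj: "inj (\<lambda>a::real^'i. \<Sum>i\<in>UNIV. a $ i *\<^sub>R F i x0)"
  shows "\<exists>B>0. \<forall>\<^sub>F x in nhds x0. \<forall>a::real^'i. B * norm a \<le> norm (\<Sum>i\<in>UNIV. a $ i *\<^sub>R F i x)"
proof -
  let ?L = "\<lambda>x. (\<lambda>a::real^'i. \<Sum>i\<in>UNIV. a $ i *\<^sub>R F i x)"
  have lin: "linear (?L x0)"
    by (rule linearI) (simp_all add: scaleR_add_left sum.distrib scaleR_sum_right)
  obtain B where B: "B > 0" "\<And>a. B * norm a \<le> norm (?L x0 a)"
    by (rule linear_inj_bounded_below_pos[OF lin inj]) blast
  have "isCont (\<lambda>x. \<Sum>i\<in>UNIV. norm (F i x - F i x0)) x0"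
    using cont by (intro continuous_intros) auto
  then have "((\<lambda>x. \<Sum>i\<in>UNIV. norm (F i x - F i x0)) \<longlongrightarrow> 0) (nhds x0)"
    using tendsto_at_iff_tendsto_nhds[of "\<lambda>x. \<Sum>i\<in>UNIV. norm (F i x - F i x0)" x0]
    by (simp add: isCont_def)
  then have "\<forall>\<^sub>F x in nhds x0. (\<Sum>i\<in>UNIV. norm (F i x - F i x0)) < B / 2"
    using B(1) by (intro order_tendstoD) auto
  then have "\<forall>\<^sub>F x in nhds x0. \<forall>a. B / 2 * norm a \<le> norm (?L x a)"
  proof (rule eventually_mono, intro allI)
    fix x and a :: "real^'i"
    assume x: "(\<Sum>i\<in>UNIV. norm (F i x - F i x0)) < B / 2"
    have "norm (?L x a - ?L x0 a) = norm (\<Sum>i\<in>UNIV. a $ i *\<^sub>R (F i x - F i x0))"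
      by (simp add: sum_subtractf scaleR_diff_right)
    also have "\<dots> \<le> (\<Sum>i\<in>UNIV. norm a * norm (F i x - F i x0))"
      by (intro order_trans[OF norm_sum] sum_mono)
        (auto intro!: mult_right_mono component_le_norm_cart)
    also have "\<dots> = norm a * (\<Sum>i\<in>UNIV. norm (F i x - F i x0))" by (simp add: sum_distrib_left)
    also have "\<dots> \<le> norm a * (B / 2)" using x by (intro mult_left_mono) auto
    finally have "norm (?L x a - ?L x0 a) \<le> norm a * (B / 2)" .
    moreover have "norm (?L x0 a) \<le> norm (?L x a) + norm (?L x a - ?L x0 a)"
      using norm_triangle_sub[of "?L x0 a" "?L x a"] by (simp add: norm_minus_commute)
    ultimately show "B / 2 * norm a \<le> norm (?L x a)" using B(2)[of a] by (simp add: field_simps)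
  qed
  then show ?thesis using B(1) by (intro exI[of _ "B/2"]) auto
qed

text \<open>If \<open>g\<close> takes values in the span of the \<open>F i\<close> and vanishes at \<open>x0\<close>, then its derivative at \<open>x0\<close>
  takes values in the span of the \<open>F i x0\<close>, which is expressed here by functionals that annihilate
  this span. The derivative is a limit of vectors \<open>g x / t\<close> in the span of the \<open>F i x\<close> with \<open>x \<rightarrow> x0\<close>;
  by the uniform independence their coefficients are bounded, while \<open>lam (F i x)\<close> tends to \<open>0\<close>.\<close>
lemma derivative_in_span_at_zero:
  fixes F :: "'i::finite \<Rightarrow> 'b::real_normed_vector \<Rightarrow> 'c::euclidean_space"
  assumes cont: "\<And>i. isCont (F i) x0"
    and inj: "inj (\<lambda>a::real^'i. \<Sum>i\<in>UNIV. a $ i *\<^sub>R F i x0)"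
    and g: "g differentiable (at x0)" "g x0 = 0"
    and span: "\<forall>\<^sub>F x in nhds x0. \<exists>a::real^'i. g x = (\<Sum>i\<in>UNIV. a $ i *\<^sub>R F i x)"
    and lam: "linear lam" "\<And>i. lam (F i x0) = (0::real)"
  shows "lam (frechet_derivative g (at x0) u) = 0"
proof -
  let ?z = "\<lambda>t::real. g (x0 + t *\<^sub>R u) /\<^sub>R t"
  let ?D = "frechet_derivative g (at x0) u"
  have gd: "(g has_derivative frechet_derivative g (at x0)) (at x0)"
    using g by (simp add: frechet_derivative_works)
  have blam: "bounded_linear lam" using lam(1) by (simp add: linear_conv_bounded_linear)
  have "((\<lambda>t. g (x0 + t *\<^sub>R u)) has_derivative (\<lambda>t. frechet_derivative g (at x0) (t *\<^sub>R u))) (at 0)"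
    by (rule has_derivative_compose[of _ _ 0 UNIV g]) (auto intro!: derivative_eq_intros gd)
  then have "((\<lambda>t. g (x0 + t *\<^sub>R u)) has_vector_derivative ?D) (at 0)"
    by (simp add: has_vector_derivative_def linear_scale[OF has_derivative_linear[OF gd]])
  then have "(\<lambda>t. norm (g (x0 + t *\<^sub>R u) - t *\<^sub>R ?D) / norm t) \<midarrow>0\<rightarrow> 0"
    using g(2) by (simp add: has_vector_derivative_def has_derivative_at)
  moreover have "\<forall>\<^sub>F t in at 0. norm (g (x0 + t *\<^sub>R u) - t *\<^sub>R ?D) / norm t = norm (?z t - ?D)"
    unfolding eventually_at_filter
  proof (rule always_eventually, intro allI impI)
    fix t :: real assume "t \<noteq> 0"
    then have "?z t - ?D = (g (x0 + t *\<^sub>R u) - t *\<^sub>R ?D) /\<^sub>R t" by (simp add: scaleR_diff_right)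
    then show "norm (g (x0 + t *\<^sub>R u) - t *\<^sub>R ?D) / norm t = norm (?z t - ?D)"
      by (simp add: divide_inverse mult.commute)
  qed
  ultimately have "((\<lambda>t. norm (?z t - ?D)) \<longlongrightarrow> 0) (at 0)"
    using tendsto_cong by fast
  then have z: "(?z \<longlongrightarrow> ?D) (at 0)"
    using Lim_null tendsto_norm_zero_iff by blast
  obtain B where B: "B > 0"
      "\<forall>\<^sub>F x in nhds x0. \<forall>a::real^'i. B * norm a \<le> norm (\<Sum>i\<in>UNIV. a $ i *\<^sub>R F i x)"
    using eventually_combination_lower_bound[OF cont inj] by blast
  let ?S = "\<lambda>x. \<Sum>i\<in>UNIV. \<bar>lam (F i x)\<bar>"
  have bound: "\<forall>\<^sub>F x in nhds x0. \<bar>lam (g x)\<bar> \<le> norm (g x) * (?S x / B)"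
    using B(2) span
  proof eventually_elim
    case (elim x)
    then obtain a :: "real^'i" where a: "g x = (\<Sum>i\<in>UNIV. a $ i *\<^sub>R F i x)" by blast
    have "lam (g x) = (\<Sum>i\<in>UNIV. a $ i * lam (F i x))"
      by (simp add: a linear_sum[OF lam(1)] linear_scale[OF lam(1)])
    then have "\<bar>lam (g x)\<bar> \<le> (\<Sum>i\<in>UNIV. norm a * \<bar>lam (F i x)\<bar>)"
      by (auto intro!: order_trans[OF sum_abs] sum_mono mult_right_mono component_le_norm_cart simp: abs_mult)
    also have "\<dots> = norm a * ?S x" by (simp add: sum_distrib_left)
    also have "\<dots> \<le> (norm (g x) / B) * ?S x"
      using elim(1) B(1) a by (intro mult_right_mono sum_nonneg) (auto simp: pos_le_divide_eq mult.commute)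
    finally show ?case by simp
  qed
  have line: "((\<lambda>t. x0 + t *\<^sub>R u) \<longlongrightarrow> x0) (at 0)"
    by (auto intro!: tendsto_eq_intros)
  have "isCont ?S x0"
    using cont by (intro continuous_intros bounded_linear.isCont[OF blam]) auto
  then have "((\<lambda>t. ?S (x0 + t *\<^sub>R u)) \<longlongrightarrow> ?S x0) (at 0)"
    by (rule isCont_tendsto_compose[OF _ line])
  then have S: "((\<lambda>t. ?S (x0 + t *\<^sub>R u)) \<longlongrightarrow> 0) (at 0)"
    using lam(2) by simp
  have "((\<lambda>t. norm (?z t) * (?S (x0 + t *\<^sub>R u) / B)) \<longlongrightarrow> norm ?D * (0 / B)) (at 0)"
    using B(1) by (intro tendsto_intros z S) auto
  moreover have "\<forall>\<^sub>F t in at 0. norm (lam (?z t)) \<le> norm (?z t) * (?S (x0 + t *\<^sub>R u) / B)"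
    using eventually_compose_filterlim[OF bound line]
  proof eventually_elim
    case (elim t)
    have "norm (lam (?z t)) = \<bar>lam (g (x0 + t *\<^sub>R u))\<bar> * \<bar>inverse t\<bar>"
      by (simp add: linear_scale[OF lam(1)] abs_mult mult.commute)
    also have "\<dots> \<le> norm (g (x0 + t *\<^sub>R u)) * (?S (x0 + t *\<^sub>R u) / B) * \<bar>inverse t\<bar>"
      using elim by (intro mult_right_mono) auto
    finally show ?case by (simp add: mult_ac)
  qed
  ultimately have "((\<lambda>t. lam (?z t)) \<longlongrightarrow> 0) (at 0)"
    by (intro Lim_null_comparison[of "\<lambda>t. lam (?z t)"]) simp_all
  moreover have "((\<lambda>t. lam (?z t)) \<longlongrightarrow> lam ?D) (at 0)"
    by (rule bounded_linear.tendsto[OF blam z])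
  ultimately show ?thesis
    using LIM_unique by blast
qed

section \<open>Linear combinations of finite families\<close>

lemma sum_fun_apply: "(\<Sum>i\<in>I. f i) x = (\<Sum>i\<in>I. f i x)"
  by (induction I rule: infinite_finite_induct) auto

text \<open>For a family indexed by a finite type, being a basis of a subspace \<open>S\<close> means that this map is
  injective with range \<open>S\<close>, so that statements about frames become statements about linear maps.\<close>
definition lincomb :: "('i::finite \<Rightarrow> 'v::real_vector) \<Rightarrow> real ^ 'i \<Rightarrow> 'v"
  where "lincomb f a = (\<Sum>i\<in>UNIV. a $ i *\<^sub>R f i)"

lemma linear_lincomb: "linear (lincomb f)"
  unfolding lincomb_def by (rule linearI) (simp_all add: scaleR_add_left sum.distrib scaleR_sum_right)

lemma lincomb_axis [simp]: "lincomb f (axis i 1) = f i"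
proof -
  have "(\<Sum>j\<in>UNIV. axis i 1 $ j *\<^sub>R f j) = (\<Sum>j\<in>UNIV. if j = i then f j else 0)"
    by (intro sum.cong) (auto simp: axis_def)
  then show ?thesis by (simp add: lincomb_def)
qed

lemma lincomb_apply: "lincomb f a x = lincomb (\<lambda>i. f i x) a"
  by (simp add: lincomb_def sum_fun_apply scaleR_fun_def)

lemma linear_image_lincomb: "linear L \<Longrightarrow> L (lincomb f a) = lincomb (\<lambda>i. L (f i)) a"
  by (simp add: lincomb_def linear_sum linear_scale)

lemma lincomb_Plus: "lincomb (case_sum f g) a = (\<Sum>i\<in>UNIV. a $ Inl i *\<^sub>R f i) + (\<Sum>j\<in>UNIV. a $ Inr j *\<^sub>R g j)"
  unfolding lincomb_def UNIV_Plus_UNIV[symmetric] by (subst sum.Plus) simp_all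

lemma span_range_eq_range_lincomb: "span (range f) = range (lincomb f)"
proof
  have "f i \<in> range (lincomb f)" for i by (metis lincomb_axis rangeI)
  then show "span (range f) \<subseteq> range (lincomb f)"
    by (intro span_minimal linear_subspace_image[OF linear_lincomb] subspace_UNIV) auto
  show "range (lincomb f) \<subseteq> span (range f)"
    unfolding lincomb_def by (intro image_subsetI span_sum span_scale span_base rangeI)
qed

lemma inj_lincomb_iff: "inj (lincomb f) \<longleftrightarrow> inj f \<and> independent (range f)"
proof safe
  assume inj: "inj (lincomb f)"
  show injf: "inj f"
  proof (rule injI)
    fix i j assume "f i = f j"
    then have "lincomb f (axis i 1) = lincomb f (axis j 1)" by simp
    then have "axis i (1::real) = axis j 1" by (rule injD[OF inj])
    then show "i = j" by (simp add: axis_eq_axis)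
  qed
  assume "dependent (range f)"
  then obtain u where u: "\<exists>v\<in>range f. u v \<noteq> 0" "(\<Sum>v\<in>range f. u v *\<^sub>R v) = 0"
    by (auto simp: dependent_finite)
  have "lincomb f (\<chi> i. u (f i)) = 0"
    using u(2) by (simp add: lincomb_def sum.reindex[OF injf])
  then have "(\<chi> i. u (f i)) = (0 :: real ^ _)"
    using inj linear_injective_0[OF linear_lincomb] by blast
  then show False using u(1) by (auto simp: vec_eq_iff)
next
  assume injf: "inj f" and indep: "independent (range f)"
  show "inj (lincomb f)"
    unfolding linear_injective_0[OF linear_lincomb]
  proof (intro allI impI)
    fix a assume "lincomb f a = 0"
    then have "(\<Sum>v\<in>range f. a $ (inv f v) *\<^sub>R v) = 0"
      using injf by (simp add: lincomb_def sum.reindex[OF injf])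
    then have "a $ (inv f v) = 0" if "v \<in> range f" for v
      using indep that dependent_finite[of "range f"] by auto
    then have "a $ i = 0" for i using injf by (metis inv_f_f rangeI)
    then show "a = 0" by (simp add: vec_eq_iff)
  qed
qed

lemma range_lincomb_eq_UNIV:
  fixes f :: "'i::finite \<Rightarrow> 'b::euclidean_space"
  assumes "inj (lincomb f)" "CARD('i) = DIM('b)"
  shows "range (lincomb f) = UNIV"
proof -
  have "dim (range (lincomb f)) = dim (UNIV :: (real^'i) set)"
    using assms(1) by (intro dim_image_eq linear_lincomb) (auto intro: inj_on_subset)
  then have "dim (range (lincomb f)) = DIM('b)" using assms(2) by simp
  then have "span (range (lincomb f)) = UNIV" by (simp add: dim_eq_full)
  then show ?thesis by (simp add: span_range_eq_range_lincomb[symmetric] span_span)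
qed

lemma exists_dual_functional:
  fixes f :: "'i::finite \<Rightarrow> 'b::euclidean_space"
  assumes "inj (lincomb f)"
  shows "\<exists>lam. linear lam \<and> (\<forall>j. lam (f j) = (if j = i then 1 else 0::real))"
proof -
  obtain g where g: "linear g" "g \<circ> lincomb f = id"
    using linear_injective_left_inverse[OF linear_lincomb assms] by blast
  have "g (f j) = axis j 1" for j using fun_cong[OF g(2), of "axis j 1"] by simp
  then have "(\<lambda>x. g x $ i) (f j) = (if j = i then 1 else 0)" for j
    by (simp add: axis_def)
  moreover have "linear (\<lambda>x. g x $ i)"
    by (rule linearI) (simp_all add: linear_add[OF g(1)] linear_scale[OF g(1)])
  ultimately show ?thesis by (intro exI[of _ "\<lambda>x. g x $ i"]) auto
qed

lemma inj_case_sum: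
  assumes "inj f" "inj g" "\<And>i j. f i \<noteq> g j"
  shows "inj (case_sum f g)"
proof (rule injI)
  fix x y assume "case_sum f g x = case_sum f g y"
  then show "x = y"
    using assms(3) assms(3)[symmetric] by (cases x; cases y) (auto dest: injD[OF assms(1)] injD[OF assms(2)])
qed

text \<open>The \<open>f i\<close> lie in the hyperplane orthogonal to \<open>a\<close>. They are extended to a basis of it, and \<open>a\<close>
  itself, scaled to have inner product \<open>1\<close> with \<open>a\<close>, becomes the vector with index \<open>\<beta>0\<close>. Inner
  product with \<open>a\<close> is thus a member of the dual basis.\<close>
lemma extend_to_adapted_basis:
  fixes f :: "'k::finite \<Rightarrow> 'b::euclidean_space"
  assumes "inj (lincomb f)" "CARD('k) + CARD('l::finite) = DIM('b)" "a \<noteq> 0" "\<And>i. a \<bullet> f i = 0"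
  obtains g :: "'l::finite \<Rightarrow> 'b" where "inj (lincomb (case_sum f g))"
     "\<And>\<beta>. a \<bullet> g \<beta> = (if \<beta> = \<beta>0 then 1 else 0)"
proof -
  define H where "H = {x. a \<bullet> x = 0}"
  have f: "inj f" "independent (range f)" using assms(1) inj_lincomb_iff by auto
  obtain B where B: "range f \<subseteq> B" "B \<subseteq> H" "independent B" "H \<subseteq> span B"
    using maximal_independent_subset_extend[of "range f" H] f assms(4) by (auto simp: H_def)
  have finB: "finite B" using B(3) independent_imp_finite by blast
  have "card B = dim H" using basis_card_eq_dim[OF B(2,4,3)] .
  then have "card B = DIM('b) - 1" using dim_hyperplane[OF assms(3)] by (simp add: H_def)
  then have "card (B - range f) = card (UNIV - {\<beta>0})"
    using B(1) f(1) assms(2) finB by (simp add: card_Diff_subset card_image)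
  then obtain h where h: "bij_betw h (UNIV - {\<beta>0}) (B - range f)"
    using finB by (metis finite finite_Diff finite_same_card_bij)
  define g where "g \<beta> = (if \<beta> = \<beta>0 then a /\<^sub>R (a \<bullet> a) else h \<beta>)" for \<beta>
  have aa: "a \<bullet> a \<noteq> 0" using assms(3) by simp
  have hB: "h \<beta> \<in> B - range f" if "\<beta> \<noteq> \<beta>0" for \<beta>
    using h that by (auto simp: bij_betw_def)
  have ag: "a \<bullet> g \<beta> = (if \<beta> = \<beta>0 then 1 else 0)" for \<beta>
    using hB[of \<beta>] B(2) aa by (auto simp: g_def H_def)
  have "subspace H" by (simp add: H_def subspace_hyperplane)
  then have spanB: "span B \<subseteq> H" using B(2) by (rule span_minimal[rotated])
  have "g \<beta>0 \<notin> span B" using spanB ag[of \<beta>0] by (auto simp: H_def)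
  then have ind: "independent (insert (g \<beta>0) B)" using B(3) by (simp add: independent_insert span_base)
  have "h ` (UNIV - {\<beta>0}) = B - range f" using h by (simp add: bij_betw_def)
  moreover have "g \<beta> \<in> insert (g \<beta>0) (h ` (UNIV - {\<beta>0}))" for \<beta> by (auto simp: g_def)
  ultimately have g_in: "g \<beta> \<in> insert (g \<beta>0) B" for \<beta> by blast
  have "case_sum f g x \<in> insert (g \<beta>0) B" for x
    using B(1) g_in by (cases x) auto
  then have "range (case_sum f g) \<subseteq> insert (g \<beta>0) B" by blast
  then have "independent (range (case_sum f g))" using ind independent_mono by blast
  moreover have "inj (case_sum f g)"
  proof -
    have "inj g"
    proof (rule injI)
      fix x y assume xy: "g x = g y"
      then have ag_eq: "a \<bullet> g x = a \<bullet> g y" by simp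
      show "x = y"
      proof (cases "x = \<beta>0 \<or> y = \<beta>0")
        case True
        then show ?thesis using ag_eq by (auto simp: ag split: if_splits)
      next
        case False
        then show ?thesis using h xy by (auto simp: g_def bij_betw_def inj_on_def)
      qed
    qed
    moreover have "f i \<noteq> g \<beta>" for i \<beta>
    proof (cases "\<beta> = \<beta>0")
      case True
      then show ?thesis using ag[of \<beta>] assms(4)[of i] by auto
    next
      case False
      then show ?thesis using hB[of \<beta>] by (auto simp: g_def) (metis rangeI)
    qed
    ultimately show ?thesis using f(1) inj_case_sum by blast
  qed
  ultimately show ?thesis using that ag by (simp add: inj_lincomb_iff)
qed

lemma not_invertible_left_kernel:
  fixes M :: "real ^ 'n ^ 'n"
  shows "\<not> invertible M \<longleftrightarrow> (\<exists>v. v \<noteq> 0 \<and> (\<forall>j. (\<Sum>i\<in>UNIV. v $ i * M $ i $ j) = 0))"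
proof -
  have "invertible M \<longleftrightarrow> invertible (transpose M)" by (simp add: invertible_det_nz)
  also have "\<dots> \<longleftrightarrow> (\<forall>v. transpose M *v v = 0 \<longrightarrow> v = 0)"
    using matrix_left_invertible_ker invertible_left_inverse by metis
  finally show ?thesis
    by (auto simp: vec_eq_iff matrix_vector_mult_def transpose_def mult.commute)
qed

section \<open>Charts and tangent vectors\<close>

locale manifold =
  fixes X :: "'a topology" and A :: "('a, 'b::euclidean_space) chart set"
  assumes smooth_manifold: "smooth_manifold X A"
begin

lemma chart:
  assumes "c \<in> A"
  shows "openin X (fst c)" "open (snd c ` fst c)"
    "homeomorphic_map (subtopology X (fst c)) (top_of_set (snd c ` fst c)) (snd c)"
  using smooth_manifold assms unfolding smooth_manifold_def is_chart_def by auto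

lemma chart_topspace:
  assumes "c \<in> A"
  shows "topspace (subtopology X (fst c)) = fst c"
  using openin_subset[OF chart(1)[OF assms]] by auto

lemma inj_on_chart: "c \<in> A \<Longrightarrow> inj_on (snd c) (fst c)"
  using homeomorphic_imp_injective_map[OF chart(3)] chart_topspace by metis

lemma chart_inv [simp]: "c \<in> A \<Longrightarrow> p \<in> fst c \<Longrightarrow> chart_inv c (snd c p) = p"
  by (simp add: chart_inv_def inj_on_chart)

lemma open_chart_image:
  assumes "c \<in> A" "openin X U"
  shows "open (snd c ` (U \<inter> fst c))"
proof -
  have "openin (subtopology X (fst c)) (U \<inter> fst c)"
    using assms(2) by (simp add: openin_subtopology_Int)
  then have "openin (top_of_set (snd c ` fst c)) (snd c ` (U \<inter> fst c))"
    using homeomorphic_map_openness[OF chart(3)] assms(1) chart_topspace by (metis inf_le2)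
  then show ?thesis using chart(2)[OF assms(1)] openin_open_trans by blast
qed

lemma openin_chart_preimage:
  assumes "c \<in> A" "open N"
  shows "openin X {p \<in> fst c. snd c p \<in> N}"
proof -
  have "continuous_map (subtopology X (fst c)) (top_of_set (snd c ` fst c)) (snd c)"
    by (rule homeomorphic_imp_continuous_map[OF chart(3)[OF assms(1)]])
  moreover have "openin (top_of_set (snd c ` fst c)) (snd c ` fst c \<inter> N)"
    using assms(2) by auto
  ultimately have "openin (subtopology X (fst c)) {p \<in> topspace (subtopology X (fst c)). snd c p \<in> snd c ` fst c \<inter> N}"
    by (rule openin_continuous_map_preimage)
  also have "{p \<in> topspace (subtopology X (fst c)). snd c p \<in> snd c ` fst c \<inter> N} = {p \<in> fst c. snd c p \<in> N}"
    unfolding chart_topspace[OF assms(1)] by auto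
  finally show ?thesis using openin_trans_full[OF _ chart(1)[OF assms(1)]] by blast
qed

lemma transition_apply [simp]:
  "c \<in> A \<Longrightarrow> p \<in> fst c \<Longrightarrow> transition c d (snd c p) = snd d p"
  by (simp add: transition_def)

lemma smooth_transition:
  assumes "c \<in> A" "d \<in> A"
  shows "smooth_on (snd c ` (fst c \<inter> fst d)) (transition c d)"
  using smooth_manifold assms unfolding smooth_manifold_def compatible_def by blast

lemma open_overlap: "c \<in> A \<Longrightarrow> d \<in> A \<Longrightarrow> open (snd c ` (fst c \<inter> fst d))"
  using open_chart_image[of c "fst d"] chart(1)[of d] by (simp add: Int_commute)

lemma transition_has_derivative:
  assumes "c \<in> A" "d \<in> A" "p \<in> fst c" "p \<in> fst d"
  shows "(transition c d has_derivative frechet_derivative (transition c d) (at (snd c p))) (at (snd c p))"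
proof -
  have "C_on (Suc 0) (snd c ` (fst c \<inter> fst d)) (transition c d)"
    using smooth_transition[OF assms(1,2)] by (simp add: smooth_on_def del: C_on.simps)
  then show ?thesis using assms by (simp add: frechet_derivative_works)
qed

lemma transition_derivative_cocycle:
  assumes "c \<in> A" "d \<in> A" "e \<in> A" "p \<in> fst c" "p \<in> fst d" "p \<in> fst e"
  shows "frechet_derivative (transition d e) (at (snd d p)) (frechet_derivative (transition c d) (at (snd c p)) v)
    = frechet_derivative (transition c e) (at (snd c p)) v"
proof -
  let ?S = "snd c ` (fst c \<inter> fst d)"
  have "((\<lambda>x. transition d e (transition c d x)) has_derivative
     (\<lambda>v. frechet_derivative (transition d e) (at (snd d p)) (frechet_derivative (transition c d) (at (snd c p)) v)))
     (at (snd c p))"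
    using transition_has_derivative[of d e p] transition_has_derivative[of c d p] assms
    by (intro has_derivative_compose[of "transition c d" _ _ UNIV "transition d e"]) auto
  moreover have "snd c p \<in> ?S" using assms by auto
  moreover have "transition d e (transition c d x) = transition c e x" if "x \<in> ?S" for x
    using that assms by auto
  ultimately have "(transition c e has_derivative
     (\<lambda>v. frechet_derivative (transition d e) (at (snd d p)) (frechet_derivative (transition c d) (at (snd c p)) v)))
     (at (snd c p))"
    using has_derivative_transform_within_open[OF _ open_overlap[OF assms(1,2)]] by blast
  then show ?thesis by (simp add: frechet_derivative_eqI)
qed

lemma transition_derivative_self:
  assumes "c \<in> A" "p \<in> fst c"
  shows "frechet_derivative (transition c c) (at (snd c p)) v = v"
proof -
  have "(transition c c has_derivative (\<lambda>v. v)) (at (snd c p))"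
    by (rule has_derivative_transform_within_open[OF has_derivative_ident open_overlap[OF assms(1,1)]])
      (use assms in auto)
  then show ?thesis by (simp add: frechet_derivative_eqI)
qed

lemma linear_transition_derivative:
  "c \<in> A \<Longrightarrow> d \<in> A \<Longrightarrow> p \<in> fst c \<Longrightarrow> p \<in> fst d \<Longrightarrow>
    linear (frechet_derivative (transition c d) (at (snd c p)))"
  using transition_has_derivative has_derivative_linear by blast

lemma tangent_spaceI:
  assumes "\<And>c. \<not> (c \<in> A \<and> p \<in> fst c) \<Longrightarrow> v c = 0"
    "\<And>c d. c \<in> A \<Longrightarrow> d \<in> A \<Longrightarrow> p \<in> fst c \<Longrightarrow> p \<in> fst d \<Longrightarrow>
       v d = frechet_derivative (transition c d) (at (snd c p)) (v c)"
  shows "v \<in> tangent_space A p"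
  using assms unfolding tangent_space_def by blast

lemma tangent_space_transition:
  assumes "v \<in> tangent_space A p" "c \<in> A" "d \<in> A" "p \<in> fst c" "p \<in> fst d"
  shows "v d = frechet_derivative (transition c d) (at (snd c p)) (v c)"
  using assms unfolding tangent_space_def by blast

lemma tangent_space_outside:
  assumes "v \<in> tangent_space A p" "\<not> (c \<in> A \<and> p \<in> fst c)"
  shows "v c = 0"
  using assms unfolding tangent_space_def by blast

lemma subspace_tangent_space: "subspace (tangent_space A p)"
  unfolding subspace_def
proof (intro conjI ballI allI)
  show "0 \<in> tangent_space A p"
    by (rule tangent_spaceI) (simp_all add: linear_0[OF linear_transition_derivative])
  fix v assume v: "v \<in> tangent_space A p"
  show "v + w \<in> tangent_space A p" if w: "w \<in> tangent_space A p" for w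
  proof (rule tangent_spaceI)
    fix c d assume *: "c \<in> A" "d \<in> A" "p \<in> fst c" "p \<in> fst d"
    show "(v + w) d = frechet_derivative (transition c d) (at (snd c p)) ((v + w) c)"
      using tangent_space_transition[OF v *] tangent_space_transition[OF w *]
        linear_add[OF linear_transition_derivative[OF *]] by simp
  qed (simp add: tangent_space_outside[OF v] tangent_space_outside[OF w])
  show "r *\<^sub>R v \<in> tangent_space A p" for r
  proof (rule tangent_spaceI)
    fix c d assume *: "c \<in> A" "d \<in> A" "p \<in> fst c" "p \<in> fst d"
    show "(r *\<^sub>R v) d = frechet_derivative (transition c d) (at (snd c p)) ((r *\<^sub>R v) c)"
      using tangent_space_transition[OF v *]
        linear_scale[OF linear_transition_derivative[OF *]] by (simp add: scaleR_fun_def)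
  qed (simp add: tangent_space_outside[OF v] scaleR_fun_def)
qed

text \<open>Together with the coordinate fields below, this identifies the tangent space with the model space
  by evaluation in any one chart.\<close>
lemma tangent_space_eqI:
  assumes "v \<in> tangent_space A p" "w \<in> tangent_space A p" "c \<in> A" "p \<in> fst c" "v c = w c"
  shows "v = w"
proof
  fix d
  show "v d = w d"
    using assms tangent_space_transition[of _ p c d] tangent_space_outside[of _ p d] by metis
qed

section \<open>Vector fields\<close>

text \<open>The field with the constant coordinate vector \<open>u\<close> in the chart \<open>c\<close>.\<close>
definition coordinate_field :: "('a, 'b) chart \<Rightarrow> 'b \<Rightarrow> ('a, 'b) vfield"
  where "coordinate_field c u p = (\<lambda>d. if d \<in> A \<and> p \<in> fst d
     then frechet_derivative (transition c d) (at (snd c p)) u else 0)"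

lemma coordinate_field_self: "c \<in> A \<Longrightarrow> p \<in> fst c \<Longrightarrow> coordinate_field c u p c = u"
  by (simp add: coordinate_field_def transition_derivative_self)

lemma coordinate_field_tangent:
  "c \<in> A \<Longrightarrow> p \<in> fst c \<Longrightarrow> coordinate_field c u p \<in> tangent_space A p"
  by (rule tangent_spaceI) (auto simp: coordinate_field_def transition_derivative_cocycle)

text \<open>In another chart \<open>d\<close>, the field is a derivative of the transition map from \<open>c\<close> to \<open>d\<close>, composed
  with the transition map from \<open>d\<close> to \<open>c\<close>.\<close>
lemma smooth_coordinate_field:
  assumes "c \<in> A"
  shows "smooth_vfield X A (fst c) (coordinate_field c u)"
  unfolding smooth_vfield_def
proof (intro conjI ballI)
  show "openin X (fst c)" using assms chart by blast
  show "coordinate_field c u p \<in> tangent_space A p" if "p \<in> fst c" for p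
    using that assms coordinate_field_tangent by blast
  fix d assume d: "d \<in> A"
  let ?S = "snd d ` (fst c \<inter> fst d)" and ?T = "snd c ` (fst c \<inter> fst d)"
  have S: "open ?S" using open_overlap[OF d assms] by (simp add: Int_commute)
  show "smooth_on ?S (coord_rep d (coordinate_field c u))"
    unfolding smooth_on_def
  proof
    fix n
    have "C_on (Suc n) ?T (transition c d)"
      using smooth_transition[OF assms d] by (simp add: smooth_on_def del: C_on.simps)
    then have "C_on n ?T (\<lambda>y. frechet_derivative (transition c d) (at y) u)" by simp
    moreover have "C_on n ?S (transition d c)"
      using smooth_transition[OF d assms] by (simp add: smooth_on_def Int_commute)
    ultimately have "C_on n ?S (\<lambda>x. frechet_derivative (transition c d) (at (transition d c x)) u)"
      using assms d
      by (intro C_on_compose[OF S, where f = "\<lambda>y. frechet_derivative (transition c d) (at y) u"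
            and g = "transition d c" and T = ?T]) auto
    then show "C_on n ?S (coord_rep d (coordinate_field c u))"
      by (rule C_on_cong[OF S, rotated]) (use assms d in \<open>auto simp: coord_rep_def coordinate_field_def\<close>)
  qed
qed

lemma coord_rep_apply: "c \<in> A \<Longrightarrow> p \<in> fst c \<Longrightarrow> coord_rep c V (snd c p) = V p c"
  by (simp add: coord_rep_def)

lemma smooth_vfield_C_on:
  "smooth_vfield X A U V \<Longrightarrow> c \<in> A \<Longrightarrow> C_on n (snd c ` (U \<inter> fst c)) (coord_rep c V)"
  by (simp add: smooth_vfield_def smooth_on_def)

lemma coord_rep_has_derivative:
  assumes "smooth_vfield X A U V" "c \<in> A" "p \<in> U" "p \<in> fst c"
  shows "(coord_rep c V has_derivative frechet_derivative (coord_rep c V) (at (snd c p))) (at (snd c p))"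
  using smooth_vfield_C_on[OF assms(1,2), of "Suc 0"] assms(3,4)
  by (auto simp: frechet_derivative_works)

lemma smooth_vfield_subset:
  assumes "smooth_vfield X A U V" "openin X U'" "U' \<subseteq> U"
  shows "smooth_vfield X A U' V"
  using assms C_on_subset[OF _ image_mono[OF Int_mono[OF assms(3) order_refl]]]
  unfolding smooth_vfield_def smooth_on_def by blast

lemma smooth_vfield_lincomb:
  assumes "openin X U" "\<And>i. smooth_vfield X A U (E i)"
  shows "smooth_vfield X A U (\<lambda>q. lincomb (\<lambda>i. E i q) a)"
  unfolding smooth_vfield_def
proof (intro conjI ballI)
  show "openin X U" by fact
  show "lincomb (\<lambda>i. E i p) a \<in> tangent_space A p" if "p \<in> U" for p
    unfolding lincomb_def using assms(2) that
    by (intro subspace_sum subspace_scale subspace_tangent_space) (simp add: smooth_vfield_def)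
  fix c assume c: "c \<in> A"
  have "C_on n (snd c ` (U \<inter> fst c)) (\<lambda>x. \<Sum>i\<in>UNIV. a $ i *\<^sub>R coord_rep c (E i) x)" for n
    using open_chart_image[OF c assms(1)] smooth_vfield_C_on[OF assms(2) c]
    by (intro C_on_sum C_on_bilinear[OF bounded_bilinear_scaleR] C_on_const) auto
  then show "smooth_on (snd c ` (U \<inter> fst c)) (coord_rep c (\<lambda>q. lincomb (\<lambda>i. E i q) a))"
    by (simp add: smooth_on_def coord_rep_def lincomb_apply) (simp add: lincomb_def)
qed

lemma coord_rep_change_chart:
  assumes "smooth_vfield X A U V" "c \<in> A" "d \<in> A" "x \<in> snd c ` (U \<inter> (fst c \<inter> fst d))"
  shows "coord_rep d V (transition c d x) = frechet_derivative (transition c d) (at x) (coord_rep c V x)"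
proof -
  obtain q where q: "q \<in> U" "q \<in> fst c" "q \<in> fst d" "x = snd c q" using assms(4) by auto
  then have "V q \<in> tangent_space A q" using assms(1) by (simp add: smooth_vfield_def)
  from tangent_space_transition[OF this assms(2,3) q(2,3)] show ?thesis
    using q assms(2,3) by (simp add: coord_rep_apply)
qed

text \<open>The representations in two charts are related by the derivative of the transition map, which
  varies with the point. Differentiating this relation therefore produces, next to the transformed
  derivative, a term with the second derivative of the transition map.\<close>
lemma derivative_coord_rep_change_chart:
  assumes V: "smooth_vfield X A U V" and cd: "c \<in> A" "d \<in> A"
    and p: "p \<in> U" "p \<in> fst c" "p \<in> fst d"
  shows "frechet_derivative (coord_rep d V) (at (snd d p)) (frechet_derivative (transition c d) (at (snd c p)) w)
    = frechet_derivative (transition c d) (at (snd c p)) (frechet_derivative (coord_rep c V) (at (snd c p)) w)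
    + frechet_derivative (\<lambda>x. frechet_derivative (transition c d) (at x) (V p c)) (at (snd c p)) w"
proof -
  let ?\<phi> = "transition c d" and ?x = "snd c p"
  let ?S = "snd c ` (U \<inter> (fst c \<inter> fst d))"
  let ?Vc = "coord_rep c V"
  have "openin X U" using V by (simp add: smooth_vfield_def)
  then have "openin X (U \<inter> fst d)" using chart(1)[OF cd(2)] by blast
  then have S: "open ?S" using open_chart_image[OF cd(1), of "U \<inter> fst d"] by (simp add: Int_ac)
  have x: "?x \<in> ?S" using p by auto
  have smooth: "C_on (Suc (Suc 0)) (snd c ` (fst c \<inter> fst d)) ?\<phi>"
    using smooth_transition[OF cd] by (simp add: smooth_on_def del: C_on.simps)
  have second: "((\<lambda>x. frechet_derivative ?\<phi> (at x) b) has_derivative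
      frechet_derivative (\<lambda>x. frechet_derivative ?\<phi> (at x) b) (at ?x)) (at ?x)" for b
    using smooth p by (auto simp: frechet_derivative_works)
  have lin: "linear (frechet_derivative ?\<phi> (at y))" if "y \<in> ?S" for y
    using that smooth by (intro linear_frechet_derivative) auto
  have Vc: "(?Vc has_derivative frechet_derivative ?Vc (at ?x)) (at ?x)"
    using coord_rep_has_derivative[OF V cd(1) p(1,2)] .
  \<comment> \<open>The direction \<open>?Vc x\<close> in which \<open>?\<phi>\<close> is differentiated varies with \<open>x\<close>; expanded in a basis, only
    derivatives in fixed directions remain.\<close>
  have split: "((\<lambda>x. \<Sum>b\<in>Basis. (?Vc x \<bullet> b) *\<^sub>R frechet_derivative ?\<phi> (at x) b) has_derivative
     (\<lambda>w. \<Sum>b\<in>Basis. (?Vc ?x \<bullet> b) *\<^sub>R frechet_derivative (\<lambda>x. frechet_derivative ?\<phi> (at x) b) (at ?x) w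
        + (frechet_derivative ?Vc (at ?x) w \<bullet> b) *\<^sub>R frechet_derivative ?\<phi> (at ?x) b)) (at ?x)" (is "(_ has_derivative ?R) _")
    by (intro has_derivative_sum has_derivative_scaleR has_derivative_inner_left Vc second)
  have via_c: "((\<lambda>x. coord_rep d V (?\<phi> x)) has_derivative ?R) (at ?x)"
    using coord_rep_change_chart[OF V cd] linear_sum_Basis[OF lin]
    by (intro has_derivative_transform_within_open[OF split S x]) simp
  have via_d: "((\<lambda>x. coord_rep d V (?\<phi> x)) has_derivative
      (\<lambda>w. frechet_derivative (coord_rep d V) (at (snd d p)) (frechet_derivative ?\<phi> (at ?x) w))) (at ?x)"
    using coord_rep_has_derivative[OF V cd(2) p(1,3)] transition_has_derivative[OF cd p(2,3)] cd(1) p(2)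
    by (intro has_derivative_compose[of ?\<phi> _ _ UNIV "coord_rep d V"]) auto
  have "frechet_derivative (coord_rep d V) (at (snd d p)) (frechet_derivative ?\<phi> (at ?x) w) = ?R w"
    using fun_cong[OF has_derivative_unique[OF via_d via_c], of w] .
  also have "\<dots> = frechet_derivative ?\<phi> (at ?x) (frechet_derivative ?Vc (at ?x) w)
     + (\<Sum>b\<in>Basis. (V p c \<bullet> b) *\<^sub>R frechet_derivative (\<lambda>x. frechet_derivative ?\<phi> (at x) b) (at ?x) w)"
    using linear_sum_Basis[OF lin[OF x], of "frechet_derivative ?Vc (at ?x) w"] cd(1) p(2)
    by (simp add: sum.distrib coord_rep_apply)
  also have "(\<Sum>b\<in>Basis. (V p c \<bullet> b) *\<^sub>R frechet_derivative (\<lambda>x. frechet_derivative ?\<phi> (at x) b) (at ?x) w)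
     = frechet_derivative (\<lambda>x. frechet_derivative ?\<phi> (at x) (V p c)) (at ?x) w"
  proof -
    have "((\<lambda>x. \<Sum>b\<in>Basis. (V p c \<bullet> b) *\<^sub>R frechet_derivative ?\<phi> (at x) b) has_derivative
      (\<lambda>w. \<Sum>b\<in>Basis. (V p c \<bullet> b) *\<^sub>R frechet_derivative (\<lambda>x. frechet_derivative ?\<phi> (at x) b) (at ?x) w)) (at ?x)"
      by (intro has_derivative_sum has_derivative_scaleR_right second)
    then have "((\<lambda>x. frechet_derivative ?\<phi> (at x) (V p c)) has_derivative
      (\<lambda>w. \<Sum>b\<in>Basis. (V p c \<bullet> b) *\<^sub>R frechet_derivative (\<lambda>x. frechet_derivative ?\<phi> (at x) b) (at ?x) w)) (at ?x)"
      by (rule has_derivative_transform_within_open[OF _ S x]) (use linear_sum_Basis[OF lin] in metis)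
    then show ?thesis by (simp add: frechet_derivative_eqI)
  qed
  finally show ?thesis .
qed

text \<open>The terms with the second derivative of the transition map are symmetric in \<open>V\<close> and \<open>W\<close> and cancel
  in the bracket.\<close>
lemma lie_bracket_tangent:
  assumes V: "smooth_vfield X A U V" "p \<in> U" and W: "smooth_vfield X A U' W" "p \<in> U'"
  shows "lie_bracket A V W p \<in> tangent_space A p"
proof -
  have "lie_bracket A V W p d = frechet_derivative (transition c d) (at (snd c p)) (lie_bracket A V W p c)"
    if cd: "c \<in> A" "d \<in> A" and p: "p \<in> fst c" "p \<in> fst d" for c d
  proof -
    let ?\<phi> = "transition c d"
    have coord: "V p d = frechet_derivative ?\<phi> (at (snd c p)) (V p c)"
       "W p d = frechet_derivative ?\<phi> (at (snd c p)) (W p c)"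
      using V W cd p tangent_space_transition by (auto simp: smooth_vfield_def)
    have "C_on 2 (snd c ` (fst c \<inter> fst d)) ?\<phi>"
      using smooth_transition[OF cd] by (simp add: smooth_on_def)
    then have "frechet_derivative (\<lambda>x. frechet_derivative ?\<phi> (at x) (V p c)) (at (snd c p)) (W p c)
      = frechet_derivative (\<lambda>x. frechet_derivative ?\<phi> (at x) (W p c)) (at (snd c p)) (V p c)"
      by (rule mixed_derivatives_commute[OF open_overlap[OF cd], rotated]) (use p in auto)
    then show ?thesis
      using cd p derivative_coord_rep_change_chart[OF V(1) cd V(2) p, of "W p c"]
       derivative_coord_rep_change_chart[OF W(1) cd W(2) p, of "V p c"]
      by (simp add: lie_bracket_def coord linear_diff[OF linear_transition_derivative[OF cd p]])
  qed
  then show ?thesis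
    by (rule tangent_spaceI[rotated]) (auto simp: lie_bracket_def)
qed

section \<open>Frames and the bracket modulo a distribution\<close>

lemma local_frame_iff:
  "local_frame X A S U UNIV E \<longleftrightarrow>
     openin X U \<and> (\<forall>i. smooth_vfield X A U (E i)) \<and>
     (\<forall>q\<in>U. inj (lincomb (\<lambda>i. E i q)) \<and> range (lincomb (\<lambda>i. E i q)) = S q)"
  unfolding local_frame_def inj_lincomb_iff span_range_eq_range_lincomb[symmetric] by auto

lemma mem_frame_iff:
  fixes E :: "'i::finite \<Rightarrow> ('a, 'b) vfield"
  assumes "local_frame X A S U UNIV E" "q \<in> U"
  shows "y \<in> S q \<longleftrightarrow> (\<exists>a. y = lincomb (\<lambda>i. E i q) a)"
proof -
  have "S q = range (lincomb (\<lambda>i. E i q))" using assms by (simp add: local_frame_iff)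
  then show ?thesis by blast
qed

lemma inj_lincomb_in_chart:
  assumes "c \<in> A" "q \<in> fst c" "\<And>i. Y i \<in> tangent_space A q"
  shows "inj (lincomb (\<lambda>i. Y i c)) \<longleftrightarrow> inj (lincomb Y)"
proof -
  have tangent: "lincomb Y a \<in> tangent_space A q" for a
    unfolding lincomb_def using assms(3) by (intro subspace_sum subspace_scale subspace_tangent_space)
  have "lincomb (\<lambda>i. Y i c) a = lincomb (\<lambda>i. Y i c) b \<longleftrightarrow> lincomb Y a = lincomb Y b" for a b
    using tangent_space_eqI[OF tangent tangent assms(1,2)] by (auto simp: lincomb_apply[symmetric])
  then show ?thesis by (simp add: inj_def)
qed

lemma frame_tangent:
  assumes "local_frame X A S U UNIV E" "q \<in> U"
  shows "E i q \<in> tangent_space A q"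
  using assms by (simp add: local_frame_def smooth_vfield_def)

text \<open>Subtracting from \<open>W\<close> the combination of the frame that has constant coefficients and the same value
  at \<open>p\<close> leaves a section that vanishes at \<open>p\<close>, whose derivative at \<open>p\<close> lies in \<open>D p\<close>.\<close>
lemma derivative_section_mod_frame:
  assumes c: "c \<in> A" "p \<in> fst c"
    and E: "local_frame X A D U UNIV E" "p \<in> U"
    and W: "W \<in> sections X A D U'" "p \<in> U'" "W p = lincomb (\<lambda>i. E i p) w"
    and lam: "linear lam" "\<And>i. lam (E i p c) = (0::real)"
  shows "lam (frechet_derivative (coord_rep c W) (at (snd c p)) u) =
    (\<Sum>j\<in>UNIV. w $ j * lam (frechet_derivative (coord_rep c (E j)) (at (snd c p)) u))"
proof -
  let ?x = "snd c p"
  let ?g = "\<lambda>x. coord_rep c W x - (\<Sum>j\<in>UNIV. w $ j *\<^sub>R coord_rep c (E j) x)"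
  have smooth: "smooth_vfield X A U' W" "\<And>i. smooth_vfield X A U (E i)"
    using W(1) E(1) by (auto simp: sections_def local_frame_iff)
  have dE: "(coord_rep c (E i) has_derivative frechet_derivative (coord_rep c (E i)) (at ?x)) (at ?x)" for i
    using coord_rep_has_derivative[OF smooth(2) c(1) E(2) c(2)] .
  have dW: "(coord_rep c W has_derivative frechet_derivative (coord_rep c W) (at ?x)) (at ?x)"
    using coord_rep_has_derivative[OF smooth(1) c(1) W(2) c(2)] .
  have dg: "(?g has_derivative (\<lambda>u. frechet_derivative (coord_rep c W) (at ?x) u
      - (\<Sum>j\<in>UNIV. w $ j *\<^sub>R frechet_derivative (coord_rep c (E j)) (at ?x) u))) (at ?x)"
    by (intro has_derivative_diff has_derivative_sum has_derivative_scaleR_right dE dW)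
  have "lam (frechet_derivative ?g (at ?x) u) = 0"
  proof (rule derivative_in_span_at_zero[where F = "\<lambda>i. coord_rep c (E i)" and lam = lam])
    show "isCont (coord_rep c (E i)) ?x" for i
      using has_derivative_continuous[OF dE] .
    have "inj (lincomb (\<lambda>i. E i p c))"
      using inj_lincomb_in_chart[OF c, of "\<lambda>i. E i p"] frame_tangent[OF E] E
      by (simp add: local_frame_iff)
    then show "inj (\<lambda>a::real^_. \<Sum>i\<in>UNIV. a $ i *\<^sub>R coord_rep c (E i) ?x)"
      by (simp add: coord_rep_apply[OF c] lincomb_def[abs_def])
    show "?g differentiable (at ?x)" using dg by (auto simp: differentiable_def)
    show "?g ?x = 0"
      using W(3) by (simp add: coord_rep_apply[OF c] lincomb_apply) (simp add: lincomb_def)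
    show "linear lam" by fact
    show "lam (coord_rep c (E i) ?x) = 0" for i by (simp add: coord_rep_apply[OF c] lam(2))
    have "openin X (U \<inter> U')"
      using E(1) smooth(1) by (auto simp: local_frame_iff smooth_vfield_def)
    then have S: "open (snd c ` ((U \<inter> U') \<inter> fst c))" using open_chart_image[OF c(1)] by blast
    have "\<exists>a::real^_. ?g x = (\<Sum>i\<in>UNIV. a $ i *\<^sub>R coord_rep c (E i) x)"
      if x: "x \<in> snd c ` ((U \<inter> U') \<inter> fst c)" for x
    proof -
      obtain q where q: "q \<in> U" "q \<in> U'" "q \<in> fst c" "x = snd c q" using x by blast
      have "W q \<in> D q" using W(1) q(2) by (simp add: sections_def)
      then obtain b where "W q = lincomb (\<lambda>i. E i q) b"
        using mem_frame_iff[OF E(1) q(1)] by blast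
      then have "?g x = lincomb (\<lambda>i. E i q c) (b - w)"
        using linear_diff[OF linear_lincomb, of "\<lambda>i. E i q c" b w] c(1) q(3,4)
        by (simp add: coord_rep_apply lincomb_apply) (simp add: lincomb_def)
      then show ?thesis using c(1) q(3,4)
        by (intro exI[of _ "b - w"]) (simp add: coord_rep_apply lincomb_def)
    qed
    then show "\<forall>\<^sub>F x in nhds ?x. \<exists>a::real^_. ?g x = (\<Sum>i\<in>UNIV. a $ i *\<^sub>R coord_rep c (E i) x)"
      unfolding eventually_nhds using S E(2) W(2) c(2) by blast
  qed
  then have "lam (frechet_derivative (coord_rep c W) (at ?x) u
      - (\<Sum>j\<in>UNIV. w $ j *\<^sub>R frechet_derivative (coord_rep c (E j)) (at ?x) u)) = 0"
    by (simp add: frechet_derivative_eqI[OF dg])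
  then show ?thesis
    by (simp add: linear_diff[OF lam(1)] linear_sum[OF lam(1)] linear_scale[OF lam(1)])
qed

text \<open>Modulo \<open>D p\<close>, the bracket of two sections is the bilinear expression in their values at \<open>p\<close> that
  one would get from constant coefficients. A functional \<open>lam\<close> that annihilates \<open>D p\<close> stands for the
  passage to the quotient.\<close>
lemma lie_bracket_mod_frame:
  assumes c: "c \<in> A" "p \<in> fst c"
    and E: "local_frame X A D U UNIV E" "p \<in> U"
    and V: "V \<in> sections X A D U1" "p \<in> U1" "V p = lincomb (\<lambda>i. E i p) v"
    and W: "W \<in> sections X A D U2" "p \<in> U2" "W p = lincomb (\<lambda>i. E i p) w"
    and lam: "linear lam" "\<And>i. lam (E i p c) = (0::real)"
  shows "lam (lie_bracket A V W p c) =
    (\<Sum>j\<in>UNIV. w $ j * (\<Sum>i\<in>UNIV. v $ i * lam (lie_bracket A (E i) (E j) p c)))"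
proof -
  let ?d = "\<lambda>Y u. lam (frechet_derivative (coord_rep c Y) (at (snd c p)) u)"
  have smooth: "smooth_vfield X A U (E i)" for i
    using E(1) by (simp add: local_frame_iff)
  have bracket: "lam (lie_bracket A Y Z p c) = ?d Z (Y p c) - ?d Y (Z p c)" for Y Z
    using c by (simp add: lie_bracket_def linear_diff[OF lam(1)])
  have lin: "linear (?d (E j))" for j
    using linear_compose[OF has_derivative_linear[OF coord_rep_has_derivative[OF smooth c(1) E(2) c(2)]] lam(1)]
    by (simp add: o_def)
  have expand: "?d (E j) (lincomb (\<lambda>i. E i p c) a) = (\<Sum>i\<in>UNIV. a $ i * ?d (E j) (E i p c))" for j a
    using linear_image_lincomb[OF lin] by (simp add: lincomb_def)
  have "lam (lie_bracket A V W p c) =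
     (\<Sum>j\<in>UNIV. \<Sum>i\<in>UNIV. w $ j * (v $ i * ?d (E j) (E i p c)))
   - (\<Sum>i\<in>UNIV. \<Sum>j\<in>UNIV. v $ i * (w $ j * ?d (E i) (E j p c)))"
    unfolding bracket derivative_section_mod_frame[OF c E V lam] derivative_section_mod_frame[OF c E W lam]
    by (simp add: V(3) W(3) lincomb_apply expand sum_distrib_left)
  also have "(\<Sum>i\<in>UNIV. \<Sum>j\<in>UNIV. v $ i * (w $ j * ?d (E i) (E j p c)))
     = (\<Sum>j\<in>UNIV. \<Sum>i\<in>UNIV. w $ j * (v $ i * ?d (E i) (E j p c)))"
    by (subst sum.swap) (simp add: mult_ac)
  finally show ?thesis
    by (simp add: bracket sum_distrib_left right_diff_distrib sum_subtractf)
qed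

lemma lincomb_section:
  fixes E :: "'i::finite \<Rightarrow> ('a, 'b) vfield"
  assumes "local_frame X A D U UNIV E"
  shows "(\<lambda>q. lincomb (\<lambda>i. E i q) a) \<in> sections X A D U"
proof -
  have "lincomb (\<lambda>i. E i q) a \<in> D q" if "q \<in> U" for q
    using mem_frame_iff[OF assms that] by blast
  then show ?thesis
    using assms smooth_vfield_lincomb[of U E a] by (simp add: sections_def local_frame_iff)
qed

lemma frame_section:
  fixes E :: "'i::finite \<Rightarrow> ('a, 'b) vfield"
  assumes "local_frame X A D U UNIV E"
  shows "E i \<in> sections X A D U"
  using lincomb_section[OF assms, of "axis i 1"] by simp

lemma lie_bracket_lincomb_right:
  assumes "c \<in> A" "p \<in> fst c" "p \<in> U" "\<And>i. smooth_vfield X A U (E i)"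
    "smooth_vfield X A U' V" "p \<in> U'"
  shows "lie_bracket A V (\<lambda>q. lincomb (\<lambda>i. E i q) a) p c = lincomb (\<lambda>i. lie_bracket A V (E i) p c) a"
proof -
  let ?x = "snd c p"
  have dE: "(coord_rep c (E i) has_derivative frechet_derivative (coord_rep c (E i)) (at ?x)) (at ?x)" for i
    using coord_rep_has_derivative[OF assms(4,1,3,2)] .
  have dV: "linear (frechet_derivative (coord_rep c V) (at ?x))"
    using has_derivative_linear[OF coord_rep_has_derivative[OF assms(5,1,6,2)]] .
  have "coord_rep c (\<lambda>q. lincomb (\<lambda>i. E i q) a) = (\<lambda>x. \<Sum>i\<in>UNIV. a $ i *\<^sub>R coord_rep c (E i) x)"
    by (simp add: coord_rep_def lincomb_apply) (simp add: lincomb_def)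
  moreover have "((\<lambda>x. \<Sum>i\<in>UNIV. a $ i *\<^sub>R coord_rep c (E i) x) has_derivative
     (\<lambda>u. \<Sum>i\<in>UNIV. a $ i *\<^sub>R frechet_derivative (coord_rep c (E i)) (at ?x) u)) (at ?x)"
    by (intro has_derivative_sum has_derivative_scaleR_right dE)
  ultimately have "frechet_derivative (coord_rep c (\<lambda>q. lincomb (\<lambda>i. E i q) a)) (at ?x) u
      = lincomb (\<lambda>i. frechet_derivative (coord_rep c (E i)) (at ?x) u) a" for u
    by (simp add: frechet_derivative_eqI lincomb_def)
  then show ?thesis
    using assms(1,2)
    by (simp add: lie_bracket_def lincomb_apply linear_image_lincomb[OF dV])
      (simp add: lincomb_def scaleR_diff_right sum_subtractf)
qed

definition structure_coefficients :: "'a set \<Rightarrow> ('k::finite \<Rightarrow> ('a, 'b) vfield) \<Rightarrow> ('l::finite \<Rightarrow> ('a, 'b) vfield)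
   \<Rightarrow> ('k \<Rightarrow> 'k \<Rightarrow> 'k \<Rightarrow> 'a \<Rightarrow> real) \<Rightarrow> ('k \<Rightarrow> 'k \<Rightarrow> 'l \<Rightarrow> 'a \<Rightarrow> real) \<Rightarrow> bool"
  where "structure_coefficients U E T C C' \<longleftrightarrow> (\<forall>i j. \<forall>p\<in>U. lie_bracket A (E i) (E j) p =
          (\<Sum>a\<in>UNIV. C i j a p *\<^sub>R E a p) + (\<Sum>\<beta>\<in>UNIV. C' i j \<beta> p *\<^sub>R T \<beta> p))"

lemma dual_functional_structure_coefficient:
  assumes "structure_coefficients U E T C C'" "p \<in> U"
    and lam: "linear lam" "\<And>i. lam (E i p c) = (0::real)"
       "\<And>\<gamma>. lam (T \<gamma> p c) = (if \<gamma> = \<beta> then 1 else 0)"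
  shows "lam (lie_bracket A (E i) (E j) p c) = C' i j \<beta> p"
proof -
  have "lie_bracket A (E i) (E j) p =
          (\<Sum>a\<in>UNIV. C i j a p *\<^sub>R E a p) + (\<Sum>\<beta>\<in>UNIV. C' i j \<beta> p *\<^sub>R T \<beta> p)"
    using assms(1,2) by (simp add: structure_coefficients_def)
  then have "lam (lie_bracket A (E i) (E j) p c) = (\<Sum>\<gamma>\<in>UNIV. C' i j \<gamma> p * (if \<gamma> = \<beta> then 1 else 0))"
    by (simp add: sum_fun_apply scaleR_fun_def linear_add[OF lam(1)] linear_sum[OF lam(1)]
        linear_scale[OF lam(1)] lam(2,3))
  then show ?thesis by (simp add: if_distrib[of "\<lambda>y. _ * y"] cong: if_cong)
qed

section \<open>Strong bracket generation and the structure coefficients\<close>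

text \<open>If the matrix has a left kernel vector \<open>v\<close>, then the functional dual to \<open>T \<beta>\<close> vanishes on \<open>D p\<close> and
  on all brackets with the section with constant coefficients \<open>v\<close>, but not on \<open>T \<beta> p\<close>.\<close>
lemma invertible_if_strong_bracket_generating:
  fixes E :: "'k::finite \<Rightarrow> ('a, 'b) vfield" and T :: "'l::finite \<Rightarrow> ('a, 'b) vfield"
  assumes sbg: "strong_bracket_generating X A D"
    and E: "local_frame X A D U UNIV E"
    and ET: "local_frame X A (tangent_space A) U UNIV (case_sum E T)"
    and C: "structure_coefficients U E T C C'"
    and p: "p \<in> U"
  shows "invertible ((\<chi> i j. C' i j \<beta> p) :: real ^ 'k ^ 'k)"
proof (rule ccontr)
  assume "\<not> ?thesis"
  then obtain v :: "real^'k" where v: "v \<noteq> 0" "\<And>j. (\<Sum>i\<in>UNIV. v $ i * C' i j \<beta> p) = 0"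
    unfolding not_invertible_left_kernel by auto
  have "p \<in> topspace X" using E p openin_subset by (fastforce simp: local_frame_iff)
  then obtain c where c: "c \<in> A" "p \<in> fst c"
    using smooth_manifold unfolding smooth_manifold_def by blast
  let ?V = "\<lambda>q. lincomb (\<lambda>i. E i q) v"
  have V: "?V \<in> sections X A D U" using lincomb_section[OF E] .
  have "inj (lincomb (\<lambda>i. E i p))" using E p by (simp add: local_frame_iff)
  then have "?V p \<noteq> 0" using v(1) linear_injective_0[OF linear_lincomb] by blast
  moreover have "?V p \<in> D p" using mem_frame_iff[OF E p] by blast
  ultimately have "D p + bracket_set X A D ?V p = tangent_space A p"
    using sbg \<open>p \<in> topspace X\<close> V p unfolding strong_bracket_generating_def by blast
  moreover have "T \<beta> p \<in> tangent_space A p"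
    using frame_tangent[OF ET p, of "Inr \<beta>"] by simp
  ultimately obtain s t where t: "T \<beta> p = s + t" and s: "s \<in> D p" and "t \<in> bracket_set X A D ?V p"
    by (metis set_plus_elim)
  then obtain W U' where W: "p \<in> U'" "W \<in> sections X A D U'"
    and T: "T \<beta> p = s + lie_bracket A ?V W p"
    unfolding bracket_set_def by blast
  have tangent: "case_sum E T x p \<in> tangent_space A p" for x using frame_tangent[OF ET p] .
  have "inj (lincomb (\<lambda>x. case_sum E T x p))" using ET p by (simp add: local_frame_iff)
  then have "inj (lincomb (\<lambda>x. case_sum E T x p c))"
    using inj_lincomb_in_chart[where Y = "\<lambda>x. case_sum E T x p", OF c tangent] by simp
  then obtain lam :: "'b \<Rightarrow> real" where lam: "linear lam"
      "\<And>x. lam (case_sum E T x p c) = (if x = Inr \<beta> then 1 else 0)"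
    using exists_dual_functional[of "\<lambda>x. case_sum E T x p c" "Inr \<beta>"] by blast
  have lamE: "lam (E i p c) = 0" for i using lam(2)[of "Inl i"] by simp
  have lamT: "lam (T \<gamma> p c) = (if \<gamma> = \<beta> then 1 else 0)" for \<gamma> using lam(2)[of "Inr \<gamma>"] by simp
  have "\<exists>a. y = lincomb (\<lambda>i. E i p) a" if "y \<in> D p" for y
    using mem_frame_iff[OF E p] that by blast
  moreover have "W p \<in> D p" using W by (simp add: sections_def)
  ultimately obtain a w where a: "s = lincomb (\<lambda>i. E i p) a" and w: "W p = lincomb (\<lambda>i. E i p) w"
    using s by metis
  have "lam (s c) = 0"
    by (simp add: a lincomb_apply linear_image_lincomb[OF lam(1)] lamE) (simp add: lincomb_def)
  moreover have "lam (lie_bracket A ?V W p c) = 0"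
    using lie_bracket_mod_frame[OF c E p V p refl W(2,1) w lam(1) lamE]
      dual_functional_structure_coefficient[OF C p lam(1) lamE lamT] v(2) by simp
  ultimately have "lam (T \<beta> p c) = 0" using T by (simp add: linear_add[OF lam(1)])
  then show False by (simp add: lamT)
qed

text \<open>At \<open>p\<close>, a complement of \<open>D p\<close> adapted to \<open>a\<close> is chosen in coordinates and continued by fields that
  are constant in the chart \<open>c\<close>. Independence persists on a neighbourhood of \<open>p\<close>.\<close>
lemma frame_with_prescribed_conormal:
  fixes E :: "'k::finite \<Rightarrow> ('a, 'b) vfield" and \<beta> :: "'l::finite"
  assumes E: "local_frame X A D U UNIV E" "p \<in> U" and c: "c \<in> A" "p \<in> fst c"
    and card: "CARD('k) + CARD('l) = DIM('b)"
    and a: "a \<noteq> 0" "\<And>i. a \<bullet> E i p c = 0"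
  obtains U' and T :: "'l \<Rightarrow> ('a, 'b) vfield"
  where "p \<in> U'" "local_frame X A D U' UNIV E"
    "local_frame X A (tangent_space A) U' UNIV (case_sum E T)"
    "\<And>\<gamma>. a \<bullet> T \<gamma> p c = (if \<gamma> = \<beta> then 1 else 0)"
proof -
  have smooth: "smooth_vfield X A U (E i)" for i using E by (simp add: local_frame_iff)
  have "inj (lincomb (\<lambda>i. E i p c))"
    using inj_lincomb_in_chart[OF c, of "\<lambda>i. E i p"] frame_tangent[OF E] E
    by (simp add: local_frame_iff)
  then obtain g :: "'l \<Rightarrow> 'b" where g: "inj (lincomb (case_sum (\<lambda>i. E i p c) g))"
    "\<And>\<gamma>. a \<bullet> g \<gamma> = (if \<gamma> = \<beta> then 1 else 0)"
    using extend_to_adapted_basis[OF _ card a(1), of "\<lambda>i. E i p c"] a(2) by metis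
  define T where "T \<gamma> = coordinate_field c (g \<gamma>)" for \<gamma>
  define F where "F = case_sum (\<lambda>i. coord_rep c (E i)) (\<lambda>\<gamma> x. g \<gamma>)"
  have F: "F x (snd c q) = case_sum E T x q c" if "q \<in> fst c" for x q
    using c(1) that by (cases x) (simp_all add: F_def T_def coord_rep_apply coordinate_field_self)
  have cont: "isCont (F x) (snd c p)" for x
    using has_derivative_continuous[OF coord_rep_has_derivative[OF smooth c(1) E(2) c(2)]]
    by (cases x) (simp_all add: F_def)
  have "(\<lambda>x. F x (snd c p)) = case_sum (\<lambda>i. E i p c) g"
    using c by (auto simp: F_def coord_rep_apply split: sum.splits)
  then have "inj (lincomb (\<lambda>x. F x (snd c p)))" using g(1) by simp
  then obtain B where B: "B > 0"
     "\<forall>\<^sub>F y in nhds (snd c p). \<forall>z::real^('k+'l). B * norm z \<le> norm (\<Sum>x\<in>UNIV. z $ x *\<^sub>R F x y)"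
    using eventually_combination_lower_bound[where F = F, OF cont] unfolding lincomb_def[abs_def] by blast
  then obtain N where N: "open N" "snd c p \<in> N"
    "\<And>y z. y \<in> N \<Longrightarrow> B * norm (z::real^('k+'l)) \<le> norm (lincomb (\<lambda>x. F x y) z)"
    unfolding eventually_nhds lincomb_def by blast
  have injN: "inj (lincomb (\<lambda>x. F x y))" if "y \<in> N" for y
    unfolding linear_injective_0[OF linear_lincomb]
  proof (intro allI impI)
    fix z :: "real^('k+'l)" assume "lincomb (\<lambda>x. F x y) z = 0"
    then have "B * norm z \<le> 0" using N(3)[OF that, of z] by simp
    then show "z = 0" using B(1) by (simp add: mult_le_0_iff)
  qed
  define U' where "U' = U \<inter> {q \<in> fst c. snd c q \<in> N}"
  have U': "openin X U'" "U' \<subseteq> U" "U' \<subseteq> fst c"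
    using E(1) openin_chart_preimage[OF c(1) N(1)] by (auto simp: U'_def local_frame_iff)
  have pU': "p \<in> U'" using E(2) c(2) N(2) by (simp add: U'_def)
  have frameE: "local_frame X A D U' UNIV E"
    using E(1) U' smooth_vfield_subset[OF smooth U'(1,2)] unfolding local_frame_iff by blast
  have smoothT: "smooth_vfield X A U' (T \<gamma>)" for \<gamma>
    unfolding T_def by (rule smooth_vfield_subset[OF smooth_coordinate_field[OF c(1)] U'(1,3)])
  have smoothET: "smooth_vfield X A U' (case_sum E T x)" for x
    using smoothT smooth_vfield_subset[OF smooth U'(1,2)] by (cases x) simp_all
  have "inj (lincomb (\<lambda>x. case_sum E T x q)) \<and> range (lincomb (\<lambda>x. case_sum E T x q)) = tangent_space A q"
    if q: "q \<in> U'" for q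
  proof -
    have qc: "q \<in> fst c" using q U'(3) by blast
    have tangent: "case_sum E T x q \<in> tangent_space A q" for x
      using smoothET q by (simp add: smooth_vfield_def)
    have lincomb_tangent: "lincomb (\<lambda>x. case_sum E T x q) z \<in> tangent_space A q" for z
      unfolding lincomb_def using tangent by (intro subspace_sum subspace_scale subspace_tangent_space)
    have inj: "inj (lincomb (\<lambda>x. case_sum E T x q c))"
      using injN[of "snd c q"] q F[OF qc] by (simp add: U'_def)
    have "range (lincomb (\<lambda>x. case_sum E T x q c)) = UNIV"
      using range_lincomb_eq_UNIV[OF inj] card by simp
    then have "\<exists>z. t c = lincomb (\<lambda>x. case_sum E T x q) z c" for t
      unfolding lincomb_apply by blast
    then have "t \<in> range (lincomb (\<lambda>x. case_sum E T x q))" if "t \<in> tangent_space A q" for t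
      using tangent_space_eqI[OF that lincomb_tangent c(1) qc] by blast
    then show ?thesis
      using inj inj_lincomb_in_chart[where Y = "\<lambda>x. case_sum E T x q", OF c(1) qc tangent] lincomb_tangent by blast
  qed
  then have "local_frame X A (tangent_space A) U' UNIV (case_sum E T)"
    using U'(1) smoothET by (simp add: local_frame_iff)
  moreover have "a \<bullet> T \<gamma> p c = (if \<gamma> = \<beta> then 1 else 0)" for \<gamma>
    using g(2) c by (simp add: T_def coordinate_field_self)
  ultimately show ?thesis by (rule that[OF pU' frameE])
qed

text \<open>The brackets are tangent vectors, hence combinations of a frame of the tangent spaces.\<close>
lemma structure_coefficients_exist:
  fixes E :: "'k::finite \<Rightarrow> ('a, 'b) vfield" and T :: "'l::finite \<Rightarrow> ('a, 'b) vfield"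
  assumes "local_frame X A (tangent_space A) U UNIV (case_sum E T)"
  obtains C C' where "structure_coefficients U E T C C'"
proof -
  have smooth: "smooth_vfield X A U (E i)" for i
    using assms unfolding local_frame_iff by (metis sum.case(1))
  have ex: "\<exists>z. p \<in> U \<longrightarrow> lie_bracket A (E i) (E j) p = lincomb (\<lambda>x. case_sum E T x p) z" for i j p
  proof (cases "p \<in> U")
    case True
    then have "lie_bracket A (E i) (E j) p \<in> tangent_space A p"
      using lie_bracket_tangent smooth by blast
    then show ?thesis using mem_frame_iff[OF assms True] by blast
  qed simp
  define z where "z i j p = (SOME z. p \<in> U \<longrightarrow> lie_bracket A (E i) (E j) p = lincomb (\<lambda>x. case_sum E T x p) z)"
    for i j p
  have z: "lie_bracket A (E i) (E j) p = lincomb (\<lambda>x. case_sum E T x p) (z i j p)" if "p \<in> U" for i j p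
    using someI_ex[OF ex[of p i j]] that by (simp add: z_def)
  have "(\<lambda>x. case_sum E T x p) = case_sum (\<lambda>i. E i p) (\<lambda>\<gamma>. T \<gamma> p)" for p
    by (auto split: sum.splits)
  then have "structure_coefficients U E T (\<lambda>i j a p. z i j p $ Inl a) (\<lambda>i j \<beta> p. z i j p $ Inr \<beta>)"
    unfolding structure_coefficients_def using z by (simp add: lincomb_Plus)
  then show ?thesis using that by blast
qed

lemma frame_at_point:
  assumes "smooth_distribution X A CARD('k::finite) D" "p \<in> topspace X"
  obtains U and E :: "'k::finite \<Rightarrow> ('a, 'b) vfield" where "p \<in> U" "local_frame X A D U UNIV E"
proof -
  obtain U and Y :: "nat \<Rightarrow> ('a, 'b) vfield" where Y: "p \<in> U" "local_frame X A D U {..<CARD('k)} Y"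
    using assms unfolding smooth_distribution_def by blast
  obtain h :: "'k \<Rightarrow> nat" where h: "bij_betw h UNIV {..<CARD('k)}"
    using finite_same_card_bij[of "UNIV :: 'k set" "{..<CARD('k)}"] by auto
  have "range (\<lambda>i. Y (h i) q) = (\<lambda>i. Y i q) ` {..<CARD('k)}" for q
    using h by (simp add: bij_betw_def image_image[symmetric, of "\<lambda>i. Y i q" h])
  moreover have "inj (\<lambda>i. Y (h i) q)" if "inj_on (\<lambda>i. Y i q) {..<CARD('k)}" for q
    using comp_inj_on[of h UNIV "\<lambda>i. Y i q"] h that by (simp add: bij_betw_def o_def)
  moreover have "h i \<in> {..<CARD('k)}" for i using h by (auto simp: bij_betw_def)
  ultimately have "local_frame X A D U UNIV (\<lambda>i. Y (h i))"
    using Y(2) unfolding local_frame_def by simp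
  then show ?thesis using that Y(1) by blast
qed

text \<open>If \<open>D p\<close> and the brackets of \<open>V\<close> with a frame did not span, some \<open>a \<noteq> 0\<close> would be orthogonal to all
  of them in coordinates. In a frame for which inner product with \<open>a\<close> is dual to \<open>T \<beta>\<close>, the
  coefficients of \<open>V p\<close> are then a left kernel vector of the matrix for \<open>\<beta>\<close>.\<close>
lemma strong_bracket_generating_if_invertible:
  fixes D
  assumes D: "smooth_distribution X A CARD('k::finite) D"
    and card: "CARD('k) + CARD('l::finite) = DIM('b)"
    and inv: "\<And>U (E :: 'k \<Rightarrow> ('a, 'b) vfield) (T :: 'l \<Rightarrow> ('a, 'b) vfield) C C' \<beta> p.
       local_frame X A D U UNIV E \<Longrightarrow>
       local_frame X A (tangent_space A) U UNIV (case_sum E T) \<Longrightarrow>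
       structure_coefficients U E T C C' \<Longrightarrow> p \<in> U \<Longrightarrow>
       invertible ((\<chi> i j. C' i j \<beta> p) :: real ^ 'k ^ 'k)"
  shows "strong_bracket_generating X A D"
  unfolding strong_bracket_generating_def
proof (intro ballI impI allI, elim conjE)
  fix p v U0 V
  assume p: "p \<in> topspace X" and v: "v \<in> D p" "v \<noteq> 0"
    and V: "p \<in> U0" "V \<in> sections X A D U0" "V p = v"
  obtain c where c: "c \<in> A" "p \<in> fst c"
    using smooth_manifold p unfolding smooth_manifold_def by blast
  obtain U and E :: "'k \<Rightarrow> ('a, 'b) vfield" where E: "local_frame X A D U UNIV E" "p \<in> U"
    using frame_at_point[OF D p] by metis
  have smoothV: "smooth_vfield X A U0 V" using V(2) by (simp add: sections_def)
  have smoothE: "smooth_vfield X A U (E i)" for i using E by (simp add: local_frame_iff)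
  have range: "range (lincomb (\<lambda>i. E i p)) = D p" using E by (simp add: local_frame_iff)
  obtain v' where v': "V p = lincomb (\<lambda>i. E i p) v'" using v(1) V(3) range by blast
  then have "v' \<noteq> 0" using v(2) V(3) linear_0[OF linear_lincomb] by metis
  have D_tangent: "D p \<subseteq> tangent_space A p" using D p by (simp add: smooth_distribution_def)
  let ?K = "range (\<lambda>i. E i p c) \<union> range (\<lambda>j. lie_bracket A V (E j) p c)"
  have spanning: "span ?K = UNIV"
  proof (rule ccontr)
    \<comment> \<open>Any index will do, since the frame is chosen to suit it.\<close>
    define \<beta> :: 'l where "\<beta> = undefined"
    assume "span ?K \<noteq> UNIV"
    then obtain a where a: "a \<noteq> 0" "\<And>x. x \<in> span ?K \<Longrightarrow> a \<bullet> x = 0"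
      using span_not_UNIV_orthogonal by blast
    have aE: "a \<bullet> E i p c = 0" for i by (intro a(2) span_base) auto
    have abr: "a \<bullet> lie_bracket A V (E j) p c = 0" for j by (intro a(2) span_base) auto
    obtain U' and T :: "'l \<Rightarrow> ('a, 'b) vfield" where U': "p \<in> U'"
      and frames: "local_frame X A D U' UNIV E" "local_frame X A (tangent_space A) U' UNIV (case_sum E T)"
      and aT: "\<And>\<gamma>. a \<bullet> T \<gamma> p c = (if \<gamma> = \<beta> then 1 else 0)"
      using frame_with_prescribed_conormal[OF E c card a(1) aE, of \<beta>] by blast
    obtain C C' where C: "structure_coefficients U' E T C C'"
      using structure_coefficients_exist[OF frames(2)] .
    have lin: "linear (\<lambda>x. a \<bullet> x)" by (simp add: bounded_linear.linear bounded_linear_inner_right)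
    have "(\<Sum>i\<in>UNIV. v' $ i * C' i j \<beta> p) = 0" for j
    proof -
      have "0 = (\<Sum>j'\<in>UNIV. axis j 1 $ j' * (\<Sum>i\<in>UNIV. v' $ i * C' i j' \<beta> p))"
        using lie_bracket_mod_frame[OF c E V(2,1) v' frame_section[OF E(1), of j] E(2), of "axis j 1", OF _ lin aE]
          dual_functional_structure_coefficient[OF C U' lin aE aT] abr[of j] by simp
      also have "\<dots> = (\<Sum>j'\<in>UNIV. if j' = j then (\<Sum>i\<in>UNIV. v' $ i * C' i j' \<beta> p) else 0)"
        by (intro sum.cong) (auto simp: axis_def)
      finally show ?thesis by simp
    qed
    then have "\<not> invertible ((\<chi> i j. C' i j \<beta> p) :: real ^ 'k ^ 'k)"
      using \<open>v' \<noteq> 0\<close> unfolding not_invertible_left_kernel by (intro exI[of _ v']) simp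
    then show False using inv[OF frames C U'] by blast
  qed
  show "D p + bracket_set X A D V p = tangent_space A p"
  proof
    show "D p + bracket_set X A D V p \<subseteq> tangent_space A p"
    proof
      fix t assume "t \<in> D p + bracket_set X A D V p"
      then obtain s b where "t = s + b" "s \<in> D p" "b \<in> bracket_set X A D V p"
        by (rule set_plus_elim)
      then obtain W U' where "t = s + lie_bracket A V W p" "s \<in> D p" "p \<in> U'" "W \<in> sections X A D U'"
        unfolding bracket_set_def by blast
      then show "t \<in> tangent_space A p"
        using lie_bracket_tangent[OF smoothV V(1), of U' W] D_tangent
          subspace_add[OF subspace_tangent_space] by (auto simp: sections_def)
    qed
    show "tangent_space A p \<subseteq> D p + bracket_set X A D V p"
    proof
      fix t assume t: "t \<in> tangent_space A p"
      \<comment> \<open>A sum of brackets of \<open>V\<close> with the frame is a single bracket of \<open>V\<close> with a combination that has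
        constant coefficients.\<close>
      have "t c \<in> span ?K" using spanning by simp
      then obtain a b where ab: "t c = lincomb (\<lambda>i. E i p c) a + lincomb (\<lambda>j. lie_bracket A V (E j) p c) b"
        unfolding span_Un span_range_eq_range_lincomb by blast
      let ?W = "\<lambda>q. lincomb (\<lambda>j. E j q) b" and ?s = "lincomb (\<lambda>i. E i p) a"
      have W: "?W \<in> sections X A D U" using lincomb_section[OF E(1)] .
      have s: "?s \<in> D p" using range by blast
      have "t = ?s + lie_bracket A V ?W p"
      proof (rule tangent_space_eqI[OF t _ c])
        show "?s + lie_bracket A V ?W p \<in> tangent_space A p"
          using lie_bracket_tangent[OF smoothV V(1) _ E(2), of ?W] W s D_tangent
            subspace_add[OF subspace_tangent_space] by (auto simp: sections_def)
        show "t c = (?s + lie_bracket A V ?W p) c"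
          using ab lie_bracket_lincomb_right[where E = E, OF c E(2) smoothE smoothV V(1)] by (simp add: lincomb_apply)
      qed
      moreover have "lie_bracket A V ?W p \<in> bracket_set X A D V p"
        using W E(2) unfolding bracket_set_def by blast
      ultimately show "t \<in> D p + bracket_set X A D V p"
        using s by (auto intro: set_plus_intro)
    qed
  qed
qed

end

theorem proposition2p1:
  fixes X :: "'a topology"
    and A :: "('a, real ^ 'm) chart set"
    and \<Sigma> :: "'a \<Rightarrow> ('a, real ^ 'm) tvec set"
  assumes "smooth_manifold X A"
    and "CARD('k::finite) + CARD('l::finite) = CARD('m::finite)"
    and "smooth_distribution X A CARD('k) \<Sigma>"
    and "\<not> integrable_distribution X A \<Sigma>"
  shows "strong_bracket_generating X A \<Sigma> \<longleftrightarrow>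
    (\<forall>U (E :: 'k \<Rightarrow> ('a, real ^ 'm) vfield) (T :: 'l \<Rightarrow> ('a, real ^ 'm) vfield)
        (C :: 'k \<Rightarrow> 'k \<Rightarrow> 'k \<Rightarrow> 'a \<Rightarrow> real) (C' :: 'k \<Rightarrow> 'k \<Rightarrow> 'l \<Rightarrow> 'a \<Rightarrow> real).
       local_frame X A \<Sigma> U UNIV E \<and>
       local_frame X A (tangent_space A) U UNIV (case_sum E T) \<and>
       (\<forall>i j. \<forall>p\<in>U. lie_bracket A (E i) (E j) p =
          (\<Sum>a\<in>UNIV. C i j a p *\<^sub>R E a p) + (\<Sum>\<beta>\<in>UNIV. C' i j \<beta> p *\<^sub>R T \<beta> p)) \<longrightarrow>
       (\<forall>\<beta>. \<forall>p\<in>U. invertible ((\<chi> i j. C' i j \<beta> p) :: real ^ 'k ^ 'k)))"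
    (is "_ \<longleftrightarrow> ?invertible")
proof -
  interpret manifold X A by (unfold_locales) (rule assms(1))
  have card: "CARD('k) + CARD('l) = DIM(real ^ 'm)" using assms(2) by simp
  show ?thesis
  proof
    assume "strong_bracket_generating X A \<Sigma>"
    then show ?invertible
      unfolding structure_coefficients_def[symmetric]
      using invertible_if_strong_bracket_generating by blast
  next
    assume inv: ?invertible
    show "strong_bracket_generating X A \<Sigma>"
    proof (rule strong_bracket_generating_if_invertible[OF assms(3) card])
      fix U and E :: "'k \<Rightarrow> ('a, real ^ 'm) vfield" and T :: "'l \<Rightarrow> ('a, real ^ 'm) vfield" and C C' \<beta> p
      assume "local_frame X A \<Sigma> U UNIV E" "local_frame X A (tangent_space A) U UNIV (case_sum E T)"
        "structure_coefficients U E T C C'" "p \<in> U"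
      then show "invertible ((\<chi> i j. C' i j \<beta> p) :: real ^ 'k ^ 'k)"
        using inv unfolding structure_coefficients_def[symmetric] by blast
    qed
  qed
qed

end
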